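(* For every $2\le q\le p<\infty$, \[ \int_0^\infty\Bigl(\Bigl(\frac{\sin\pi t}{\pi t}\Bigr)^*\Bigr)^q t^{q/p-1}\,dt\le\int_0^\infty e^{-\pi q t^2/2}\,t^{q/p-1}\,dt . \] Equivalently, for all $q\ge2$ and $0<\alpha\le1$, \[ \int_0^\infty\Bigl(\Bigl(\frac{\sin t}{t}\Bigr)^*\Bigr)^q t^{\alpha-1}\,dt\le\frac12\,q^{-\alpha/2}(2\pi)^{\alpha/2}\,\Gamma(\alpha/2). \]
   Context: For a measurable function $h$ on $(0,\infty)$ (Lebesgue measure), $h^*$ denotes its nonincreasing rearrangement $h^*(s)=\inf\{\tau>0:\ |\{t>0:|h(t)|>\tau\}|\le s\}$; here $h(t)=\sin(\pi t)/(\pi t)$ (resp. $\sin t/t$) on $(0,\infty)$. $\Gamma$ is the Gamma function. *)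

theory Defs
  imports "HOL-Analysis.Analysis"
begin

definition rearr :: "(real \<Rightarrow> real) \<Rightarrow> real \<Rightarrow> real" where
  "rearr h s = Inf {\<tau>::real. \<tau> > 0 \<and>
       emeasure lborel {t::real. t > 0 \<and> \<bar>h t\<bar> > \<tau>} \<le> ennreal s}"

definition sinc_pi :: "real \<Rightarrow> real" where
  "sinc_pi t = sin (pi * t) / (pi * t)"

definition sinc :: "real \<Rightarrow> real" where
  "sinc t = sin t / t"

end

theory Submission
  imports "HOL-Probability.Sinc_Integral" Defs
begin

text \<open>
  Let \<open>f\<close> be the rearrangement of \<open>sin (\<pi>t) / (\<pi>t)\<close> and \<open>g(t) = exp (- \<pi>t\<^sup>2/2)\<close>. Following Nazarov and
  Podkorytov, the distribution functions of \<open>f\<close> and \<open>g\<close> cross exactly once, at a height \<open>v\<close>: above the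
  highest side lobe the product formula gives \<open>sinc \<le> g\<close>; below height \<open>1/8\<close> the lobes of sinc are
  long enough; in between, the distribution function of sinc is steeper than that of \<open>g\<close>. Hence
  \<open>v \<le> f \<le> g\<close> to the left of some \<open>T\<close> and \<open>g \<le> f \<le> v\<close> to the right of it. With
  \<open>c = (q/2) v\<^bsup>q-2\<^esup> T\<^bsup>\<alpha>-1\<^esup>\<close> this yields, pointwise,
  \<open>(f\<^sup>q - g\<^sup>q) t\<^bsup>\<alpha>-1\<^esup> \<le> c (f\<^sup>2 - g\<^sup>2)\<close>, and the right-hand side has integral zero because
  \<open>f\<close> and \<open>g\<close> have the same \<open>L\<^sup>2\<close> norm.
\<close>

subsection \<open>The cardinal sine\<close>

lemma sin_ge_sin:
  assumes "0 \<le> a" "a \<le> pi / 2" "a \<le> x" "x \<le> pi - a"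
  shows "sin a \<le> sin x"
proof (cases "x \<le> pi / 2")
  case True
  then show ?thesis using assms by (intro sin_monotone_2pi_le) auto
next
  case False
  then have "sin a \<le> sin (pi - x)" using assms by (intro sin_monotone_2pi_le) auto
  then show ?thesis by simp
qed

lemma abs_sin_pi_mult_add_nat: "\<bar>sin (pi * (of_nat k + s))\<bar> = \<bar>sin (pi * s)\<bar>"
  by (simp add: distrib_left sin_add abs_mult)

text \<open>\<open>\<bar>sin\<bar>\<close> is even and has period pi, so only the distance of
  \<open>t\<close> from 1 counts; up to distance 1/2 the sine is increasing in it.\<close>

lemma abs_sin_pi_mult_le_near_1:
  assumes "1 - a \<le> t" "t \<le> 1 + a" "a \<le> 1 / 2"
  shows "\<bar>sin (pi * t)\<bar> \<le> sin (pi * a)"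
proof -
  define u where "u = \<bar>t - 1\<bar>"
  have u: "0 \<le> u" "u \<le> a" using assms by (auto simp: u_def)
  have "pi * u \<le> pi * a" "pi * a \<le> pi * (1 / 2)"
    using u assms by (intro mult_left_mono; simp)+
  then have pu: "0 \<le> pi * u" "pi * u \<le> pi * a" "pi * a \<le> pi / 2"
    using u by auto
  have "\<bar>sin (pi * t)\<bar> = \<bar>sin (pi * (t - 1))\<bar>"
    using abs_sin_pi_mult_add_nat[of 1 "t - 1"] by simp
  also have "\<dots> = \<bar>sin (pi * u)\<bar>"
    using sin_minus[of "pi * (t - 1)"] by (auto simp: u_def abs_if algebra_simps)
  also have "\<dots> = sin (pi * u)"
    using pu by (intro abs_of_nonneg sin_ge_zero) auto
  also have "\<dots> \<le> sin (pi * a)"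
    by (rule sin_monotone_2pi_le) (use pu pi_gt_zero in linarith)+
  finally show ?thesis .
qed

lemma abs_sinc_pi_le_1: "\<bar>sinc_pi t\<bar> \<le> 1"
  using abs_sin_x_le_abs_x[of "pi * t"] by (auto simp: sinc_pi_def abs_mult divide_le_eq_1)

lemma abs_sinc_pi_eq:
  assumes "t > 0"
  shows "\<bar>sinc_pi t\<bar> = \<bar>sin (pi * t)\<bar> / (pi * t)"
  using assms by (simp add: sinc_pi_def abs_mult)

lemma abs_sinc_pi_le:
  assumes "t > 0" "\<bar>sin (pi * t)\<bar> \<le> c" "a \<le> t" "a > 0"
  shows "\<bar>sinc_pi t\<bar> \<le> c / (pi * a)"
  using assms by (simp add: abs_sinc_pi_eq frac_le)

lemma borel_measurable_sinc_pi [measurable]: "sinc_pi \<in> borel_measurable borel"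
  unfolding sinc_pi_def by measurable

text \<open>Euler's product together with \<open>1 - x \<le> exp (- x)\<close>. Since t < 1, all
  factors are nonnegative and the bounds may be multiplied. The exponents sum to pi^2/6 times t^2,
  and pi^2/6 exceeds pi/2 because pi > 3.\<close>

lemma sinc_pi_le_gauss:
  assumes "0 < t" "t < 1"
  shows "sinc_pi t \<le> exp (- pi * t\<^sup>2 / 2)"
proof -
  have 1: "(\<lambda>n. \<Prod>k=1..n. 1 - t^2 / of_nat k^2) \<longlonglongrightarrow> sinc_pi t"
    unfolding sinc_pi_def using sin_product_formula_real'[of t] assms by simp
  have 2: "(\<lambda>n. \<Sum>k<n. 1 / (real k + 1)\<^sup>2) \<longlonglongrightarrow> pi\<^sup>2 / 6"
    using inverse_squares_sums by (simp add: sums_def add.commute)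
  have 3: "(\<lambda>n. exp (- t\<^sup>2 * (\<Sum>k<n. 1 / (real k + 1)\<^sup>2))) \<longlonglongrightarrow> exp (- t\<^sup>2 * (pi\<^sup>2 / 6))"
    by (intro tendsto_intros 2)
  have 4: "(\<Prod>k=1..n. 1 - t^2 / of_nat k^2) \<le> exp (- t\<^sup>2 * (\<Sum>k<n. 1 / (real k + 1)\<^sup>2))" for n
  proof -
    have "(\<Prod>k=1..n. 1 - t^2 / of_nat k^2) \<le> (\<Prod>k=1..n. exp (- (t^2 / of_nat k^2)))"
    proof (intro prod_mono conjI)
      fix k assume "k \<in> {1..n}"
      then have "t \<le> real k" using assms by auto
      then have "t\<^sup>2 \<le> (real k)\<^sup>2" using assms by (intro power_mono) auto
      then show "0 \<le> 1 - t\<^sup>2 / (real k)\<^sup>2" by (auto simp: divide_le_eq_1)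
      show "1 - t\<^sup>2 / (real k)\<^sup>2 \<le> exp (- (t\<^sup>2 / (real k)\<^sup>2))"
        using exp_ge_add_one_self[of "- (t\<^sup>2 / (real k)\<^sup>2)"] by simp
    qed
    also have "\<dots> = exp (\<Sum>k=1..n. - (t^2 / of_nat k^2))" by (simp add: exp_sum)
    also have "(\<Sum>k=1..n. - (t^2 / of_nat k^2)) = - t\<^sup>2 * (\<Sum>k=1..n. 1 / of_nat k^2)"
      by (simp add: sum_distrib_left sum_negf)
    also have "(\<Sum>k=1..n. 1 / (of_nat k^2 :: real)) = (\<Sum>k<n. 1 / (real k + 1)\<^sup>2)"
      by (rule sum.reindex_bij_witness[of _ Suc "\<lambda>k. k - 1"]) (auto simp: add.commute of_nat_diff)
    finally show ?thesis .
  qed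
  have "sinc_pi t \<le> exp (- t\<^sup>2 * (pi\<^sup>2 / 6))"
    by (rule LIMSEQ_le[OF 1 3]) (use 4 in auto)
  also have "\<dots> \<le> exp (- pi * t\<^sup>2 / 2)"
  proof -
    have "3 * pi \<le> pi\<^sup>2" using pi_gt3 by (simp add: power2_eq_square)
    then have "t\<^sup>2 * (3 * pi) \<le> t\<^sup>2 * pi\<^sup>2" by (intro mult_left_mono) auto
    then show ?thesis by (simp add: algebra_simps)
  qed
  finally show ?thesis .
qed

section \<open>Lipschitz bounds and crossings of a band of levels\<close>

text \<open>The derivative is \<open>(cos (pi * t) - sinc_pi t) / t\<close>: its numerator is at
  most 1 + M in absolute value and its denominator is at least \<open>a\<close>.\<close>

lemma abs_sinc_pi_lipschitz:
  assumes "0 < a" and M: "\<And>t. a \<le> t \<Longrightarrow> t \<le> b \<Longrightarrow> \<bar>sinc_pi t\<bar> \<le> M"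
    and "a \<le> s" "s \<le> b" "a \<le> t" "t \<le> b"
  shows "\<bar>\<bar>sinc_pi s\<bar> - \<bar>sinc_pi t\<bar>\<bar> \<le> (1 + M) / a * \<bar>s - t\<bar>"
proof -
  have "norm (sinc_pi s - sinc_pi t) \<le> (1 + M) / a * norm (s - t)"
  proof (rule field_differentiable_bound[where S = "{a..b}" and f' = "\<lambda>t. (cos (pi * t) - sinc_pi t) / t"])
    fix t assume t: "t \<in> {a..b}"
    then have t0: "t > 0" using assms by auto
    show "(sinc_pi has_field_derivative (cos (pi * t) - sinc_pi t) / t) (at t within {a..b})"
      unfolding sinc_pi_def [abs_def] using t0
      by (auto intro!: derivative_eq_intros simp: field_simps)
    have "\<bar>cos (pi * t) - sinc_pi t\<bar> \<le> 1 + M"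
      using M[of t] t abs_cos_le_one[of "pi * t"]
        abs_triangle_ineq4[of "cos (pi * t)" "sinc_pi t"]
      unfolding atLeastAtMost_iff by linarith
    then have "\<bar>cos (pi * t) - sinc_pi t\<bar> / t \<le> (1 + M) / a"
      using t assms by (intro frac_le) auto
    then show "norm ((cos (pi * t) - sinc_pi t) / t) \<le> (1 + M) / a"
      using t0 by (simp add: abs_mult)
  qed (use assms in auto)
  then show ?thesis by (simp add: real_norm_def)
qed

lemma continuous_on_abs_sinc_pi:
  assumes "0 < a"
  shows "continuous_on {a..b} (\<lambda>t. \<bar>sinc_pi t\<bar>)"
  unfolding sinc_pi_def using assms by (intro continuous_intros) auto

text \<open>Take \<open>d\<close> as the first point where \<open>h\<close> equals \<open>z\<close>
  and \<open>c\<close> as the last point before \<open>d\<close> where it equals \<open>y\<close>.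
  By the intermediate value theorem, leaving the band strictly between them would produce an earlier
  \<open>d\<close> or a later \<open>c\<close>.\<close>

lemma increasing_crossing_interval:
  fixes h :: "real \<Rightarrow> real"
  assumes "a \<le> b" and cont: "continuous_on {a..b} h" and "h a \<le> y" "y < z" "z \<le> h b"
  shows "\<exists>c d. a \<le> c \<and> c < d \<and> d \<le> b \<and> h c = y \<and> h d = z \<and> (\<forall>t. c < t \<and> t < d \<longrightarrow> y < h t \<and> h t < z)"
proof -
  have compact: "compact {t \<in> {a'..b'}. h t = v}" if "a \<le> a'" "b' \<le> b" for a' b' v
  proof -
    have "closed {t \<in> {a'..b'}. h t = v}"
      by (intro continuous_closed_preimage_constant continuous_on_subset[OF cont]) (use that in auto)
    then have "compact ({a'..b'} \<inter> {t \<in> {a'..b'}. h t = v})" by (intro compact_Int_closed) auto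
    moreover have "{a'..b'} \<inter> {t \<in> {a'..b'}. h t = v} = {t \<in> {a'..b'}. h t = v}" by auto
    ultimately show ?thesis by simp
  qed
  have root: "\<exists>t \<in> {a'..b'}. h t = v" if "a \<le> a'" "b' \<le> b" "a' \<le> b'" "h a' \<le> v" "v \<le> h b'" for a' b' v
    using IVT'[of h a' v b'] that continuous_on_subset[OF cont, of "{a'..b'}"] by auto
  have "{t \<in> {a..b}. h t = z} \<noteq> {}" using root[of a b z] assms by auto
  from compact_attains_inf[OF compact[of a b z] this]
  obtain d where d: "a \<le> d" "d \<le> b" "h d = z" and dmin: "\<And>t. a \<le> t \<Longrightarrow> t \<le> b \<Longrightarrow> h t = z \<Longrightarrow> d \<le> t"
    by auto
  have "{t \<in> {a..d}. h t = y} \<noteq> {}" using root[of a d y] assms d by auto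
  from compact_attains_sup[OF compact[of a d y] this]
  obtain c where c: "a \<le> c" "c \<le> d" "h c = y" and cmax: "\<And>t. a \<le> t \<Longrightarrow> t \<le> d \<Longrightarrow> h t = y \<Longrightarrow> t \<le> c"
    using d by auto
  have "y < h t \<and> h t < z" if t: "c < t" "t < d" for t
  proof
    show "y < h t"
    proof (rule ccontr)
      assume "\<not> y < h t"
      then obtain u where "u \<in> {t..d}" "h u = y" using root[of t d y] t c d assms by auto
      then show False using cmax[of u] t c by auto
    qed
    show "h t < z"
    proof (rule ccontr)
      assume "\<not> h t < z"
      then obtain u where "u \<in> {a..t}" "h u = z" using root[of a t z] t c d assms by auto
      then show False using dmin[of u] t d by auto
    qed
  qed
  moreover have "c < d" using c d assms by (cases "c = d") auto
  ultimately show ?thesis using c d by blast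
qed

text \<open>A function with Lipschitz constant \<open>L\<close> needs length at least (z - y)/L to
  cross the band from \<open>y\<close> to \<open>z\<close>; this turns slope bounds into lower
  bounds for measures. The decreasing case follows by the reflection t -> a + b - t.\<close>

lemma crossing_interval:
  fixes h :: "real \<Rightarrow> real"
  assumes "a \<le> b" "continuous_on {a..b} h" "y < z"
    and ends: "h a \<le> y \<and> z \<le> h b \<or> h b \<le> y \<and> z \<le> h a"
    and lip: "\<And>s t. a \<le> s \<Longrightarrow> s \<le> b \<Longrightarrow> a \<le> t \<Longrightarrow> t \<le> b \<Longrightarrow> \<bar>h s - h t\<bar> \<le> L * \<bar>s - t\<bar>"
  shows "\<exists>c d. a \<le> c \<and> c < d \<and> d \<le> b \<and> z - y \<le> L * (d - c) \<and> (\<forall>t. c < t \<and> t < d \<longrightarrow> y < h t \<and> h t < z)"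
  using ends
proof
  assume "h a \<le> y \<and> z \<le> h b"
  then obtain c d where cd: "a \<le> c" "c < d" "d \<le> b" "h c = y" "h d = z"
    "\<forall>t. c < t \<and> t < d \<longrightarrow> y < h t \<and> h t < z"
    using increasing_crossing_interval[of a b h y z] assms by blast
  then have "z - y \<le> L * (d - c)" using lip[of c d] by auto
  then show ?thesis using cd by blast
next
  assume e: "h b \<le> y \<and> z \<le> h a"
  have "continuous_on {a..b} (\<lambda>t. h (a + b - t))"
    by (intro continuous_on_compose2[OF assms(2)] continuous_intros) auto
  then obtain c d where cd: "a \<le> c" "c < d" "d \<le> b" "h (a + b - c) = y" "h (a + b - d) = z"
    "\<forall>t. c < t \<and> t < d \<longrightarrow> y < h (a + b - t) \<and> h (a + b - t) < z"
    using increasing_crossing_interval[of a b "\<lambda>t. h (a + b - t)" y z] assms e by auto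
  show ?thesis
  proof (intro exI conjI allI impI)
    fix t assume "a + b - d < t \<and> t < a + b - c"
    then show "y < h t" "h t < z" using cd(6)[rule_format, of "a + b - t"] by auto
  next
    show "z - y \<le> L * ((a + b - c) - (a + b - d))"
      using lip[of "a + b - c" "a + b - d"] cd by auto
  qed (use cd in auto)
qed

section \<open>The square integral of the cardinal sine\<close>

text \<open>Integrating sin^2(pi t)/(pi t)^2 by parts leads to the antiderivative \<open>F\<close>,
  built from the sine integral \<open>Si\<close>. It vanishes at 0 and tends to (pi/2)/pi at
  infinity.\<close>

lemma nn_integral_sinc_pi_square:
  "(\<integral>\<^sup>+ t\<in>{0<..}. ennreal ((sinc_pi t)\<^sup>2) \<partial>lborel) = ennreal (1 / 2)"
proof -
  \<comment> \<open>\<open>S\<close> has value 1 at 0, whereas \<open>sinc_pi 0\<close> is 0/0 = 0.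
    The continuous version makes \<open>F\<close> differentiable at the endpoint 0 too.\<close>
  define S where "S = (\<lambda>x::real. if x = 0 then 1 else sin x / x)"
  define F where "F x = (Si (2 * pi * x) - pi * x * (S (pi * x))\<^sup>2) / pi" for x
  have S_isCont: "isCont S x" for x unfolding S_def by (rule isCont_sinc)
  have D: "(F has_real_derivative (S (pi * x))\<^sup>2) (at x)" if "0 \<le> x" for x
  proof -
    have dSi: "((\<lambda>x. Si (2 * pi * x)) has_real_derivative S (2 * pi * x) * (2 * pi)) (at x)"
      unfolding S_def by (rule DERIV_chain2[OF DERIV_Si]) (auto intro!: derivative_eq_intros)
    show ?thesis
    proof (cases "x = 0")
      case True
      \<comment> \<open>At 0 the difference quotient is \<open>pi * (S (pi * x))\<^sup>2\<close>, so
        continuity of \<open>S\<close> alone gives the derivative.\<close>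
      have "((\<lambda>x. pi * x * (S (pi * x))\<^sup>2) has_real_derivative pi) (at 0)"
        unfolding has_field_derivative_iff
      proof (rule Lim_transform_eventually)
        have "isCont (\<lambda>x. pi * (S (pi * x))\<^sup>2) 0"
          by (intro continuous_intros isCont_o2[OF _ S_isCont])
        then show "((\<lambda>x. pi * (S (pi * x))\<^sup>2) \<longlongrightarrow> pi) (at 0)"
          by (simp add: isCont_def S_def)
        show "\<forall>\<^sub>F x in at 0. pi * (S (pi * x))\<^sup>2 =
            (pi * x * (S (pi * x))\<^sup>2 - pi * 0 * (S (pi * 0))\<^sup>2) / (x - 0)"
          by (auto simp: eventually_at_filter)
      qed
      then show ?thesis
        unfolding F_def [abs_def] using DERIV_cdivide[OF DERIV_diff[OF dSi], of _ _ pi] True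
        by (fastforce simp: S_def)
    next
      case False
      then have x: "x > 0" using that by simp
      \<comment> \<open>Away from 0 the second term of \<open>F\<close> is sin^2(pi x)/(pi x). By
        the double angle formula the mixed term of its derivative cancels the derivative of the
        \<open>Si\<close> term.\<close>
      have "((\<lambda>x. (sin (pi * x))\<^sup>2 / (pi * x)) has_real_derivative
          2 * sin (pi * x) * cos (pi * x) / x - (sin (pi * x))\<^sup>2 / (pi * x\<^sup>2)) (at x)"
        using x by (auto intro!: derivative_eq_intros simp: field_simps power2_eq_square)
      from DERIV_cdivide[OF DERIV_diff[OF dSi this], of pi]
      have "((\<lambda>x. (Si (2 * pi * x) - (sin (pi * x))\<^sup>2 / (pi * x)) / pi) has_real_derivative
          (S (2 * pi * x) * (2 * pi) - (2 * sin (pi * x) * cos (pi * x) / x - (sin (pi * x))\<^sup>2 / (pi * x\<^sup>2))) / pi) (at x)" .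
      moreover have "S (2 * pi * x) * (2 * pi) = 2 * sin (pi * x) * cos (pi * x) / x"
        using x sin_double[of "pi * x"] by (simp add: S_def mult.assoc)
      moreover have "(sin (pi * x))\<^sup>2 / (pi * x\<^sup>2) / pi = (S (pi * x))\<^sup>2"
        using x by (simp add: S_def power2_eq_square)
      ultimately have "((\<lambda>x. (Si (2 * pi * x) - (sin (pi * x))\<^sup>2 / (pi * x)) / pi)
          has_real_derivative (S (pi * x))\<^sup>2) (at x)" by simp
      then show ?thesis
      proof (rule has_field_derivative_transform_within_open[of _ _ _ "{0<..}"])
        show "(Si (2 * pi * x) - (sin (pi * x))\<^sup>2 / (pi * x)) / pi = F x" if "x \<in> {0<..}" for x
          using that by (simp add: F_def S_def power2_eq_square)
      qed (use x in auto)
    qed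
  qed
  have lim: "(F \<longlongrightarrow> 1 / 2) at_top"
  proof -
    have "filterlim (\<lambda>x. 2 * pi * x) at_top at_top"
      by (intro filterlim_tendsto_pos_mult_at_top[OF tendsto_const] filterlim_ident) auto
    then have 1: "((\<lambda>x. Si (2 * pi * x)) \<longlongrightarrow> pi / 2) at_top"
      by (rule filterlim_compose[OF Si_at_top])
    have "((\<lambda>x. (1 / pi) / x) \<longlongrightarrow> 0) at_top"
      by (intro real_tendsto_divide_at_top[OF tendsto_const] filterlim_ident)
    then have 2: "((\<lambda>x. pi * x * (S (pi * x))\<^sup>2) \<longlongrightarrow> 0) at_top"
    proof (rule Lim_null_comparison[rotated])
      show "\<forall>\<^sub>F x in at_top. norm (pi * x * (S (pi * x))\<^sup>2) \<le> (1 / pi) / x"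
        using eventually_gt_at_top[of 0]
      proof eventually_elim
        case (elim x)
        have "(sin (pi * x))\<^sup>2 \<le> 1" by (simp add: abs_square_le_1)
        then have "(sin (pi * x))\<^sup>2 / (pi * x) \<le> 1 / (pi * x)" using elim by (intro divide_right_mono) auto
        then show ?case using elim by (simp add: S_def power2_eq_square)
      qed
    qed
    have "((\<lambda>x. (Si (2 * pi * x) - pi * x * (S (pi * x))\<^sup>2) / pi) \<longlongrightarrow> (pi / 2 - 0) / pi) at_top"
      by (intro tendsto_intros 1 2) auto
    then show ?thesis unfolding F_def [abs_def] by simp
  qed
  have [measurable]: "S \<in> borel_measurable borel"
    unfolding S_def by (rule borel_measurable_sinc)
  have "(\<integral>\<^sup>+ t\<in>{0<..}. ennreal ((sinc_pi t)\<^sup>2) \<partial>lborel)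
      = (\<integral>\<^sup>+ t. ennreal ((S (pi * t))\<^sup>2) * indicator {0..} t \<partial>lborel)"
  proof (rule nn_integral_cong_AE)
    show "AE t in lborel. ennreal ((sinc_pi t)\<^sup>2) * indicator {0<..} t = ennreal ((S (pi * t))\<^sup>2) * indicator {0..} t"
      using AE_lborel_singleton[of 0]
      by eventually_elim (auto simp: S_def sinc_pi_def indicator_def)
  qed
  also have "\<dots> = ennreal (1 / 2 - F 0)"
    by (rule nn_integral_FTC_atLeast[OF _ D _ lim]) auto
  also have "F 0 = 0" using Si_neg[of 0] by (simp add: F_def)
  finally show ?thesis by simp
qed

subsection \<open>Crossing of the distribution functions\<close>

definition sinc_dist :: "real \<Rightarrow> real" where
  "sinc_dist y = measure lborel {t. t > 0 \<and> \<bar>sinc_pi t\<bar> > y}"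

text \<open>The solution t \<ge> 0 of exp(-pi t^2/2) = y, hence for 0 < y < 1 the distribution
  function of the Gaussian on the half-line.\<close>

definition gauss_dist :: "real \<Rightarrow> real" where
  "gauss_dist y = sqrt (2 * ln (1 / y) / pi)"

text \<open>The decay 1/(pi t) confines the set to a bounded interval, so \<open>sinc_dist\<close>
  is a genuine finite measure at positive levels.\<close>

lemma superlevel_sinc_pi_subset:
  assumes "y > 0"
  shows "{t. t > 0 \<and> \<bar>sinc_pi t\<bar> > y} \<subseteq> {0<..<1 / (pi * y)}"
proof clarsimp
  fix t assume t: "0 < t" "y < \<bar>sinc_pi t\<bar>"
  then have "y < 1 / (pi * t)" using abs_sinc_pi_le[of t 1 t] by simp
  then show "t < 1 / (pi * y)" using t assms by (simp add: field_simps)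
qed

lemma superlevel_sinc_pi_lmeasurable [simp]:
  assumes "y > 0"
  shows "{t. t > 0 \<and> \<bar>sinc_pi t\<bar> > y} \<in> fmeasurable lborel"
proof (rule fmeasurableI2[of "{0<..<1 / (pi * y)}"])
  show "{0<..<1 / (pi * y)} \<in> fmeasurable lborel"
    using fmeasurable_box[of 0 "1 / (pi * y)"] by (simp add: box_real)
qed (use superlevel_sinc_pi_subset[OF assms] in auto)

lemma emeasure_superlevel_sinc_pi:
  assumes "y > 0"
  shows "emeasure lborel {t. t > 0 \<and> \<bar>sinc_pi t\<bar> > y} = ennreal (sinc_dist y)"
  unfolding sinc_dist_def
  by (rule emeasure_eq_measure2[OF superlevel_sinc_pi_lmeasurable[OF assms]])

lemma sinc_dist_ge:
  assumes "y > 0" "A \<in> sets lborel" "A \<subseteq> {t. t > 0 \<and> \<bar>sinc_pi t\<bar> > y}"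
  shows "measure lborel A \<le> sinc_dist y"
  unfolding sinc_dist_def using assms by (intro measure_mono_fmeasurable) auto

lemma less_gauss_dist_iff:
  assumes "0 < y" "y < 1" "0 \<le> t"
  shows "t < gauss_dist y \<longleftrightarrow> y < exp (- pi * t\<^sup>2 / 2)"
proof -
  have "t < gauss_dist y \<longleftrightarrow> t\<^sup>2 < 2 * ln (1 / y) / pi"
    unfolding gauss_dist_def using assms by (metis real_less_rsqrt real_sqrt_less_iff real_sqrt_pow2_iff real_sqrt_power real_sqrt_abs abs_of_nonneg)
  also have "\<dots> \<longleftrightarrow> ln y < - pi * t\<^sup>2 / 2"
    using assms by (auto simp: ln_div field_simps)
  also have "\<dots> \<longleftrightarrow> y < exp (- pi * t\<^sup>2 / 2)"
    using assms by (metis exp_less_cancel_iff exp_ln)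
  finally show ?thesis .
qed

lemma gauss_dist_gauss:
  assumes "0 \<le> t"
  shows "gauss_dist (exp (- pi * t\<^sup>2 / 2)) = t"
  unfolding gauss_dist_def using assms by (simp add: ln_div)

lemma gauss_dist_strict_antimono:
  assumes "0 < y" "y < z" "z \<le> 1"
  shows "gauss_dist z < gauss_dist y"
  unfolding gauss_dist_def using assms by (simp add: ln_div divide_strict_right_mono)

section \<open>Slopes of the two distribution functions at intermediate levels\<close>

text \<open>Up to 5/4 the sine is at most sin(pi/4), which gives 3/(4 pi), about 0.239; beyond 5/4
  the bound 1/(pi t) gives at most 4/(5 pi), about 0.2546. The latter fixes the constant
  0.255.\<close>

lemma abs_sinc_pi_le_of_ge_1:
  assumes "1 \<le> t"
  shows "\<bar>sinc_pi t\<bar> \<le> 51 / 200"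
proof (cases "t \<le> 5 / 4")
  case True
  have "\<bar>sin (pi * t)\<bar> \<le> sin (pi / 4)"
    using abs_sin_pi_mult_le_near_1[of "1 / 4" t] assms True by simp
  also have "\<dots> \<le> 3 / 4"
  proof -
    have "sqrt 2 \<le> 3 / 2" by (intro real_le_lsqrt) (simp_all add: power2_eq_square)
    then show ?thesis by (simp add: sin_45)
  qed
  finally have "\<bar>sinc_pi t\<bar> \<le> 3 / 4 / (pi * 1)"
    using assms by (intro abs_sinc_pi_le) auto
  also have "\<dots> \<le> 51 / 200" using pi_approx(1) by (simp add: field_simps)
  finally show ?thesis .
next
  case False
  then have "\<bar>sinc_pi t\<bar> \<le> 1 / (pi * (5 / 4))"
    using assms by (intro abs_sinc_pi_le) auto
  also have "\<dots> \<le> 51 / 200" using pi_approx(1) by (simp add: field_simps)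
  finally show ?thesis .
qed

text \<open>The derivative is -1/(pi x G) with G = \<open>gauss_dist x\<close>, and (pi x G)^2 = 2
  pi x^2 ln(1/x) is at least pi/16 here. This gives the constant 4/sqrt(pi), about 2.257; it is
  rounded up to 2.3, the slope that \<open>sinc_dist_slope\<close> provides for the cardinal
  sine.\<close>

lemma gauss_dist_lipschitz:
  assumes "1 / 8 \<le> y" "y < z" "z \<le> 51 / 200"
  shows "gauss_dist y - gauss_dist z \<le> 23 / 10 * (z - y)"
proof -
  have "\<exists>x>y. x < z \<and> gauss_dist z - gauss_dist y = (z - y) * (- 1 / (pi * x * gauss_dist x))"
  proof (rule MVT2[OF \<open>y < z\<close>])
    fix x assume "y \<le> x" "x \<le> z"
    then have x: "0 < x" "x < 1" using assms by auto
    then have "0 < 2 * ln (1 / x) / pi"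
      by (intro divide_pos_pos mult_pos_pos ln_gt_zero) auto
    then show "(gauss_dist has_real_derivative - 1 / (pi * x * gauss_dist x)) (at x)"
      unfolding gauss_dist_def [abs_def] using x
      by (auto intro!: derivative_eq_intros simp: field_simps power2_eq_square)
  qed
  then obtain x where x: "y < x" "x < z"
    and eq: "gauss_dist z - gauss_dist y = (z - y) * (- 1 / (pi * x * gauss_dist x))" by blast
  \<comment> \<open>\<open>x\<^sup>2 ln (1/x)\<close> is smallest at the left end \<open>1/8\<close> of the range\<close>
  define u where "u = 8 * x"
  have u: "1 \<le> u" "u \<le> 51 / 25" using x assms by (auto simp: u_def)
  have x01: "0 < x" "x < 1" using x assms by auto
  have "ln 8 = 3 * ln (2::real)" using ln_realpow[of 2 3] by simp
  then have l8: "2 \<le> ln (8::real)" using ln2_ge_two_thirds by simp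
  have "ln (1 / x) = ln 8 - ln u" using x01 by (simp add: u_def ln_div ln_mult)
  also have "\<dots> \<ge> 3 - u" using ln_le_minus_one[of u] u l8 by simp
  finally have "u\<^sup>2 * (3 - u) \<le> u\<^sup>2 * ln (1 / x)" by (intro mult_left_mono) auto
  \<comment> \<open>With ln 8 \<ge> 2 and ln u \<le> u - 1, the claim
    \<open>1 / 32 \<le> x\<^sup>2 * ln (1 / x)\<close> reduces to u^2 (3 - u) \<ge> 2, an equality
    at u = 1; hence the factor u - 1.\<close>
  moreover have "u\<^sup>2 * (3 - u) - 2 = (u - 1) * (2 * (u + 1) - u * u)"
    by (simp add: algebra_simps power2_eq_square power3_eq_cube)
  moreover have "0 \<le> (u - 1) * (2 * (u + 1) - u * u)"
  proof (rule mult_nonneg_nonneg)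
    have "u * u \<le> 51 / 25 * u" using u by (intro mult_right_mono) auto
    also have "\<dots> \<le> 2 * (u + 1)" using u by simp
    finally show "0 \<le> 2 * (u + 1) - u * u" by simp
  qed (use u in simp)
  ultimately have l: "1 / 32 \<le> x\<^sup>2 * ln (1 / x)" by (simp add: u_def power_mult_distrib)
  have G0: "0 \<le> 2 * ln (1 / x) / pi"
    using x01 by (intro divide_nonneg_nonneg mult_nonneg_nonneg ln_ge_zero) auto
  then have Gnn: "0 \<le> gauss_dist x" unfolding gauss_dist_def by (rule real_sqrt_ge_zero)
  have sq: "(gauss_dist x)\<^sup>2 = 2 * ln (1 / x) / pi"
    unfolding gauss_dist_def using G0 by (rule real_sqrt_pow2)
  have "(10 / 23)\<^sup>2 \<le> pi / 16" using pi_approx(1) by (simp add: power2_eq_square)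
  also have "\<dots> = 2 * pi * (1 / 32)" by simp
  also have "\<dots> \<le> 2 * pi * (x\<^sup>2 * ln (1 / x))" using l by (intro mult_left_mono) auto
  also have "\<dots> = (pi * x * gauss_dist x)\<^sup>2"
    unfolding power_mult_distrib sq by (simp add: power2_eq_square)
  finally have "10 / 23 \<le> pi * x * gauss_dist x"
    by (rule power2_le_imp_le) (use x01 Gnn in simp)
  then have "1 / (pi * x * gauss_dist x) \<le> 1 / (10 / 23)" by (intro divide_left_mono) auto
  then have "(z - y) * (1 / (pi * x * gauss_dist x)) \<le> (z - y) * (23 / 10)"
    using assms by (intro mult_left_mono) auto
  moreover have "gauss_dist y - gauss_dist z = (z - y) * (1 / (pi * x * gauss_dist x))"
    using eq by simp
  ultimately show ?thesis by (simp only: mult.commute)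
qed

text \<open>The maximum over the compact interval [7/6, 2] is at least the value 2/(3 pi) at 3/2. On
  [1, 7/6], where the sine is at most 1/2, and beyond 2 the function stays below 1/(2 pi). The bound
  7/6 \<le> \<tau> later improves the Lipschitz constant to the right of the peak.\<close>

lemma sinc_pi_peak:
  obtains \<tau> where "7 / 6 \<le> \<tau>" "\<tau> \<le> 2" "\<And>t. 1 \<le> t \<Longrightarrow> \<bar>sinc_pi t\<bar> \<le> \<bar>sinc_pi \<tau>\<bar>" "1 / 5 < \<bar>sinc_pi \<tau>\<bar>"
proof -
  obtain \<tau> where \<tau>: "\<tau> \<in> {7 / 6..2}" "\<And>t. t \<in> {7 / 6..2} \<Longrightarrow> \<bar>sinc_pi t\<bar> \<le> \<bar>sinc_pi \<tau>\<bar>"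
    using continuous_attains_sup[OF _ _ continuous_on_abs_sinc_pi[of "7/6" 2]] by auto
  have "sin (3 / 2 * pi) = - 1" by (rule sin_3over2_pi)
  then have "\<bar>sinc_pi (3 / 2)\<bar> = 2 / (3 * pi)" by (simp add: abs_sinc_pi_eq mult.commute)
  then have v: "2 / (3 * pi) \<le> \<bar>sinc_pi \<tau>\<bar>" using \<tau>(2)[of "3/2"] by simp
  have "\<bar>sinc_pi t\<bar> \<le> \<bar>sinc_pi \<tau>\<bar>" if t: "1 \<le> t" for t
  proof -
    consider "t \<le> 7 / 6" | "t \<in> {7/6..2}" | "2 \<le> t" using t by fastforce
    then show ?thesis
    proof cases
      case 1
      have "\<bar>sin (pi * t)\<bar> \<le> sin (pi / 6)"
        using abs_sin_pi_mult_le_near_1[of "1 / 6" t] t 1 by simp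
      then have "\<bar>sinc_pi t\<bar> \<le> 1 / 2 / (pi * 1)"
        using t by (intro abs_sinc_pi_le) (auto simp: sin_30)
      also have "\<dots> \<le> 2 / (3 * pi)" by (simp add: field_simps)
      finally show ?thesis using v by simp
    next
      case 3
      then have "\<bar>sinc_pi t\<bar> \<le> 1 / (pi * 2)"
        using t by (intro abs_sinc_pi_le) auto
      also have "\<dots> \<le> 2 / (3 * pi)" by (simp add: field_simps)
      finally show ?thesis using v by simp
    qed (use \<tau> in auto)
  qed
  moreover have "1 / 5 < 2 / (3 * pi)" using pi_approx(2) by (simp add: field_simps)
  then have "1 / 5 < \<bar>sinc_pi \<tau>\<bar>" using v by linarith
  ultimately show ?thesis using that[of \<tau>] \<tau>(1) by simp
qed

text \<open>Below the height of the first side lobe, each level is met on three branches of the graph: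
  one in \<open>[3/4, 1]\<close> and one on either side of the peak \<open>\<tau>\<close>. Each branch of Lipschitz constant \<open>L\<close>
  contributes at least \<open>1/L\<close> to the slope of the distribution function.\<close>

lemma sinc_dist_slope:
  assumes \<tau>: "7 / 6 \<le> \<tau>" "\<tau> \<le> 2" and yz: "0 < y" "y < z" "z \<le> \<bar>sinc_pi \<tau>\<bar>"
  shows "23 / 10 * (z - y) \<le> sinc_dist y - sinc_dist z"
proof -
  let ?h = "\<lambda>t. \<bar>sinc_pi t\<bar>"
  have z: "z \<le> 51 / 200" using abs_sinc_pi_le_of_ge_1[of \<tau>] \<tau> yz by simp
  have zero: "sinc_pi 1 = 0" "sinc_pi 2 = 0"
    by (auto simp: sinc_pi_def mult.commute[of pi])
  have s2: "7 / 5 \<le> sqrt 2" "sqrt 2 \<le> 1415 / 1000"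
    by (intro real_le_lsqrt real_le_rsqrt; simp add: power2_eq_square)+
  have s34: "sin (pi * (3 / 4)) = sqrt 2 / 2"
    using sin_45 sin_pi_minus[of "pi / 4"] by (simp add: algebra_simps)
  \<comment> \<open>At 3/4 the main lobe is still above 0.255 and so above the band; at 1 it is
    zero. The band is therefore crossed on [3/4, 1].\<close>
  have "?h (3 / 4) = sqrt 2 / 2 / (pi * (3 / 4))"
    by (subst abs_sinc_pi_eq, simp, subst s34, simp)
  moreover have "51 / 200 \<le> 7 / 10 / (pi * (3 / 4))" using pi_approx(2) by (simp add: field_simps)
  moreover have "7 / 10 / (pi * (3 / 4)) \<le> sqrt 2 / 2 / (pi * (3 / 4))"
    using s2 by (intro divide_right_mono) auto
  ultimately have h34: "z \<le> ?h (3 / 4)" using z by linarith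
  have b1: "?h t \<le> 301 / 1000" if "3 / 4 \<le> t" "t \<le> 1" for t
  proof -
    have "\<bar>sin (pi * t)\<bar> \<le> sin (pi / 4)"
      using abs_sin_pi_mult_le_near_1[of "1 / 4" t] that by simp
    then have "?h t \<le> (1415 / 2000) / (pi * (3 / 4))"
      using that s2 by (intro abs_sinc_pi_le) (auto simp: sin_45)
    also have "\<dots> \<le> 301 / 1000" using pi_approx(1) by (simp add: field_simps)
    finally show ?thesis .
  qed
  have "\<exists>c d. 3/4 \<le> c \<and> c < d \<and> d \<le> 1 \<and> z - y \<le> (1 + 301/1000) / (3/4) * (d - c)
      \<and> (\<forall>t. c < t \<and> t < d \<longrightarrow> y < ?h t \<and> ?h t < z)"
    using zero yz h34
    by (intro crossing_interval abs_sinc_pi_lipschitz continuous_on_abs_sinc_pi b1) auto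
  then obtain c1 d1 where 1: "3/4 \<le> c1" "c1 < d1" "d1 \<le> 1" "z - y \<le> (1 + 301/1000) / (3/4) * (d1 - c1)"
      "\<And>t. c1 < t \<Longrightarrow> t < d1 \<Longrightarrow> y < ?h t \<and> ?h t < z" by blast
  have "\<exists>c d. 1 \<le> c \<and> c < d \<and> d \<le> \<tau> \<and> z - y \<le> (1 + 51/200) / 1 * (d - c)
      \<and> (\<forall>t. c < t \<and> t < d \<longrightarrow> y < ?h t \<and> ?h t < z)"
    using zero yz \<tau>
    by (intro crossing_interval abs_sinc_pi_lipschitz continuous_on_abs_sinc_pi abs_sinc_pi_le_of_ge_1) auto
  then obtain c2 d2 where 2: "1 \<le> c2" "c2 < d2" "d2 \<le> \<tau>" "z - y \<le> (1 + 51/200) * (d2 - c2)"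
      "\<And>t. c2 < t \<Longrightarrow> t < d2 \<Longrightarrow> y < ?h t \<and> ?h t < z" by auto
  have "\<exists>c d. \<tau> \<le> c \<and> c < d \<and> d \<le> 2 \<and> z - y \<le> (1 + 51/200) / \<tau> * (d - c)
      \<and> (\<forall>t. c < t \<and> t < d \<longrightarrow> y < ?h t \<and> ?h t < z)"
    using zero yz \<tau>
    by (intro crossing_interval abs_sinc_pi_lipschitz continuous_on_abs_sinc_pi abs_sinc_pi_le_of_ge_1) auto
  then obtain c3 d3 where 3: "\<tau> \<le> c3" "c3 < d3" "d3 \<le> 2" "z - y \<le> (1 + 51/200) / \<tau> * (d3 - c3)"
      "\<And>t. c3 < t \<Longrightarrow> t < d3 \<Longrightarrow> y < ?h t \<and> ?h t < z" by auto
  have "(1 + 51/200) / \<tau> \<le> (1 + 51/200) / (7/6)"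
    using \<tau> by (intro divide_left_mono) auto
  then have "(1 + 51/200) / \<tau> * (d3 - c3) \<le> (1 + 51/200) / (7/6) * (d3 - c3)"
    using 3 by (intro mult_right_mono) auto
  then have "z - y \<le> (1 + 51/200) / (7/6) * (d3 - c3)" using 3 by linarith
  \<comment> \<open>The reciprocal Lipschitz constants of the three branches are about 0.576, 0.797
    and 0.930; their sum 2.303 just exceeds 2.3.\<close>
  then have len: "23 / 10 * (z - y) \<le> (d1 - c1) + (d2 - c2) + (d3 - c3)"
    using 1 2 yz by simp
  let ?S = "\<lambda>y. {t. t > 0 \<and> \<bar>sinc_pi t\<bar> > y}"
  let ?I = "{c1<..<d1} \<union> {c2<..<d2} \<union> {c3<..<d3}"
  have "measure lborel ({c1<..<d1} \<union> {c2<..<d2}) = (d1 - c1) + (d2 - c2)"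
    using 1(1-3) 2(1-3) by (subst measure_Union) auto
  moreover have "measure lborel ?I = measure lborel ({c1<..<d1} \<union> {c2<..<d2}) + measure lborel {c3<..<d3}"
  proof (rule measure_Union)
    show "emeasure lborel ({c1<..<d1} \<union> {c2<..<d2}) \<noteq> \<infinity>"
      using emeasure_bounded_finite[of "{c1<..<d1} \<union> {c2<..<d2}"] by auto
    show "({c1<..<d1} \<union> {c2<..<d2}) \<inter> {c3<..<d3} = {}"
      using 1(1-3) 2(1-3) 3(1-3) by fastforce
  qed (use 3(1-3) in auto)
  ultimately have "measure lborel ?I = (d1 - c1) + (d2 - c2) + (d3 - c3)"
    using 3(2) by simp
  \<comment> \<open>The three disjoint intervals lie where
    \<open>y < \<bar>sinc_pi t\<bar> < z\<close>, so their total length is lost when the level rises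
    from \<open>y\<close> to \<open>z\<close>.\<close>
  moreover have "measure lborel ?I \<le> measure lborel (?S y - ?S z)"
  proof (rule measure_mono_fmeasurable)
    have "t \<in> ?S y - ?S z" if "t \<in> ?I" for t
      using that 1(1) 2(1) 3(1) \<tau> 1(5)[of t] 2(5)[of t] 3(5)[of t] by auto
    then show "?I \<subseteq> ?S y - ?S z" by blast
  qed (use yz in auto)
  moreover have "measure lborel (?S y - ?S z) = sinc_dist y - sinc_dist z"
    unfolding sinc_dist_def using yz by (intro measure_Diff) (auto simp: emeasure_superlevel_sinc_pi)
  ultimately show ?thesis using len by linarith
qed

section \<open>Levels up to 1/8\<close>

text \<open>It is enough to have pi t/8 < |sin(pi t)| on (0, 5/6) and on (7/6, 7/4), whose lengths
  5/6 and 7/12 add up to 17/12.\<close>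

lemma sinc_dist_ge_two_lobes:
  assumes "0 < y" "y \<le> 1 / 8"
  shows "17 / 12 \<le> sinc_dist y"
proof -
  have pi_less: "pi < 16 / 5" using pi_approx(2) by simp
  let ?A = "{0<..<5 / 6} \<union> {7 / 6<..<7 / 4 :: real}"
  have "?A \<subseteq> {t. t > 0 \<and> \<bar>sinc_pi t\<bar> > y}"
  proof
    fix t assume "t \<in> ?A"
    \<comment> \<open>Near 0 the bound is sin x \<ge> x/2. On the next two ranges |sin| \<ge> 1/2,
      and on the last |sin| \<ge> sqrt 2/2 \<ge> 7/10. With pi < 16/5, pi t/8 stays below 1/2 up to
      t = 5/4 and below 7/10 up to t = 7/4.\<close>
    then consider "0 < t" "t \<le> 1 / 6" | "1 / 6 < t" "t < 5 / 6" | "7 / 6 < t" "t \<le> 5 / 4" | "5 / 4 < t" "t < 7 / 4"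
      by fastforce
    then have t: "t > 0 \<and> pi * t / 8 < \<bar>sin (pi * t)\<bar>"
    proof cases
      case 1
      have "\<exists>z>0. z < pi * t \<and> sin (pi * t) - sin 0 = (pi * t - 0) * cos z"
        using 1 by (intro MVT2) (auto intro!: derivative_eq_intros)
      then obtain z where z: "0 < z" "z < pi * t" "sin (pi * t) = pi * t * cos z" by auto
      have "pi * t \<le> pi * (1 / 6)" using 1 by (intro mult_left_mono) auto
      then have "cos (pi / 3) \<le> cos z"
        by (intro cos_monotone_0_pi_le) (use z pi_gt_zero in linarith)+
      then have "pi * t * (1 / 2) \<le> sin (pi * t)"
        unfolding z(3) using 1 by (intro mult_left_mono) (auto simp: cos_60)
      moreover have "pi * t / 8 < pi * t * (1 / 2)" using 1 by simp
      ultimately show ?thesis using 1 by linarith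
    next
      case 2
      have "pi * (1 / 6) \<le> pi * t" "pi * t \<le> pi * (5 / 6)" using 2 by (intro mult_left_mono; simp)+
      then have "sin (pi / 6) \<le> sin (pi * t)" by (intro sin_ge_sin) auto
      moreover have "pi * t / 8 < 1 / 2" using \<open>pi * t \<le> pi * (5 / 6)\<close> pi_less_4 by linarith
      ultimately show ?thesis using 2 by (auto simp: sin_30)
    next
      case 3
      have "pi * (1 / 6) \<le> pi * (t - 1)" "pi * (t - 1) \<le> pi * (1 / 4)"
        using 3 by (intro mult_left_mono; simp)+
      then have "sin (pi / 6) \<le> sin (pi * (t - 1))" by (intro sin_ge_sin) auto
      moreover have "\<bar>sin (pi * t)\<bar> = \<bar>sin (pi * (t - 1))\<bar>"
        using abs_sin_pi_mult_add_nat[of 1 "t - 1"] by simp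
      moreover have "pi * t / 8 < 1 / 2"
        using mult_left_mono[OF \<open>t \<le> 5 / 4\<close> pi_ge_zero] pi_less by linarith
      ultimately show ?thesis using 3 by (auto simp: sin_30)
    next
      case 4
      have "pi * (1 / 4) \<le> pi * (t - 1)" "pi * (t - 1) \<le> pi * (3 / 4)"
        using 4 by (intro mult_left_mono; simp)+
      then have "sin (pi / 4) \<le> sin (pi * (t - 1))" by (intro sin_ge_sin) auto
      moreover have "\<bar>sin (pi * t)\<bar> = \<bar>sin (pi * (t - 1))\<bar>"
        using abs_sin_pi_mult_add_nat[of 1 "t - 1"] by simp
      moreover have "pi * t / 8 < 7 / 10"
        using mult_left_mono[OF less_imp_le[OF \<open>t < 7 / 4\<close>] pi_ge_zero] pi_less by linarith
      moreover have "7 / 5 \<le> sqrt 2" by (intro real_le_rsqrt) (simp add: power2_eq_square)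
      ultimately show ?thesis using 4 by (auto simp: sin_45)
    qed
    then have "pi * t * y \<le> pi * t / 8"
      using mult_left_mono[OF assms(2), of "pi * t"] t by simp
    then have "pi * t * y < \<bar>sin (pi * t)\<bar>" using t by linarith
    then have "y < \<bar>sin (pi * t)\<bar> / (pi * t)" using t by (simp add: pos_less_divide_eq mult_ac)
    then show "t \<in> {t. t > 0 \<and> \<bar>sinc_pi t\<bar> > y}" using t by (simp add: abs_sinc_pi_eq)
  qed
  then have "measure lborel ?A \<le> sinc_dist y" using assms by (intro sinc_dist_ge) auto
  moreover have "measure lborel ?A = 17 / 12"
    by (subst measure_Union) auto
  ultimately show ?thesis by simp
qed

text \<open>On the middle two thirds of each lobe |sin(pi t)| \<ge> 1/2, while for t < n the
  hypothesis gives y pi t < 1/2. So each of the first \<open>n\<close> lobes contributes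
  2/3.\<close>

lemma sinc_dist_ge_lobes:
  assumes "0 < y" "2 * pi * real n * y \<le> 1"
  shows "2 / 3 * real n \<le> sinc_dist y"
proof -
  let ?A = "\<lambda>k::nat. {real k + 1 / 6<..<real k + 5 / 6}"
  have "disjoint_family_on ?A {..<n}"
  proof (unfold disjoint_family_on_def, intro ballI impI)
    fix k l :: nat assume "k \<noteq> l"
    then have "real k + 1 \<le> real l \<or> real l + 1 \<le> real k" by linarith
    then show "?A k \<inter> ?A l = {}" by auto
  qed
  then have "measure lborel (\<Union>k<n. ?A k) = (\<Sum>k<n. measure lborel (?A k))"
    by (intro measure_finite_Union) auto
  also have "\<dots> = 2 / 3 * real n" by simp
  finally have "measure lborel (\<Union>k<n. ?A k) = 2 / 3 * real n" .
  moreover have "measure lborel (\<Union>k<n. ?A k) \<le> sinc_dist y"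
  proof (rule sinc_dist_ge)
    show "(\<Union>k<n. ?A k) \<subseteq> {t. 0 < t \<and> y < \<bar>sinc_pi t\<bar>}"
    proof
      fix t assume "t \<in> (\<Union>k<n. ?A k)"
      then obtain k where k: "k < n" and t: "t \<in> ?A k" by blast
      have t0: "t > 0" using t by auto
      have "pi * (1 / 6) < pi * (t - real k)" "pi * (t - real k) < pi * (5 / 6)"
        using t by (intro mult_strict_left_mono; simp)+
      then have "sin (pi / 6) \<le> sin (pi * (t - real k))" by (intro sin_ge_sin) auto
      moreover have "\<bar>sin (pi * t)\<bar> = \<bar>sin (pi * (t - real k))\<bar>"
        using abs_sin_pi_mult_add_nat[of k "t - real k"] by simp
      ultimately have "1 / 2 \<le> \<bar>sin (pi * t)\<bar>" by (auto simp: sin_30)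
      moreover have "t < real n" using t k by auto
      then have "y * (pi * t) < y * (pi * real n)"
        using assms by (intro mult_strict_left_mono) auto
      moreover have "y * (pi * real n) \<le> 1 / 2" using assms by (simp add: mult_ac)
      ultimately have "y * (pi * t) < \<bar>sin (pi * t)\<bar>" by linarith
      then show "t \<in> {t. 0 < t \<and> y < \<bar>sinc_pi t\<bar>}"
        using t0 by (simp add: abs_sinc_pi_eq pos_less_divide_eq)
    qed
  qed (use assms in auto)
  ultimately show ?thesis by simp
qed

text \<open>For y \<le> 1/(6 pi) at least three lobes can be counted by
  \<open>sinc_dist_ge_lobes\<close>, and their number outgrows the square root of a logarithm. The
  remaining levels up to 1/8 are covered by the two-lobe bound.\<close>

lemma gauss_dist_less_sinc_dist:
  assumes "0 < y" "y \<le> 1 / 8"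
  shows "gauss_dist y < sinc_dist y"
proof (cases "6 * pi * y \<le> 1")
  case True
  \<comment> \<open>The largest \<open>n\<close> that \<open>sinc_dist_ge_lobes\<close> admits at
    level \<open>y\<close>.\<close>
  define n where "n = nat \<lfloor>1 / (2 * pi * y)\<rfloor>"
  have py: "0 < 2 * pi * y" using assms by simp
  have "0 \<le> \<lfloor>1 / (2 * pi * y)\<rfloor>" using py by simp
  then have n: "real n \<le> 1 / (2 * pi * y)" "1 / (2 * pi * y) < real n + 1"
    unfolding n_def by linarith+
  have "3 \<le> 1 / (2 * pi * y)" using True assms by (simp add: field_simps)
  then have "3 \<le> \<lfloor>1 / (2 * pi * y)\<rfloor>" by (simp add: le_floor_iff)
  then have n3: "3 \<le> real n" unfolding n_def by linarith
  \<comment> \<open>From 1/y \<le> 8 (n + 1) the square of \<open>gauss_dist y\<close> is bounded by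
    2/3 (n + 25/12), which is below (2n/3)^2 as soon as n \<ge> 3.\<close>
  have "1 / y = 1 / (2 * pi * y) * (2 * pi)" using assms by simp
  also have "\<dots> \<le> (real n + 1) * 8" using n pi_less_4 by (intro mult_mono) auto
  finally have "ln (1 / y) \<le> ln ((real n + 1) * 8)" using assms by (subst ln_le_cancel_iff) auto
  also have "\<dots> = ln (real n + 1) + ln 8" by (subst ln_mult) auto
  also have "ln 8 = 3 * ln (2::real)" using ln_realpow[of 2 3] by simp
  also have "ln (real n + 1) + 3 * ln 2 \<le> real n + 3 * (25 / 36)"
    using ln_le_minus_one[of "real n + 1"] ln2_le_25_over_36 by simp
  finally have l: "ln (1 / y) \<le> real n + 3 * (25 / 36)" .
  have "2 * ln (1 / y) / pi \<le> 2 * (real n + 3 * (25 / 36)) / 3"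
    using l assms pi_gt3 by (intro frac_le) auto
  also have "\<dots> < 4 / 9 * (real n * 3)" using n3 by simp
  also have "\<dots> \<le> 4 / 9 * (real n * real n)" using n3 by (intro mult_left_mono) auto
  also have "\<dots> = (2 / 3 * real n)\<^sup>2" by (simp add: power2_eq_square)
  finally have "gauss_dist y < 2 / 3 * real n"
    unfolding gauss_dist_def by (intro real_less_lsqrt) auto
  also have "\<dots> \<le> sinc_dist y"
    using n py assms by (intro sinc_dist_ge_lobes) (auto simp: field_simps)
  finally show ?thesis .
next
  case False
  then have "1 / y \<le> 6 * pi" using assms by (simp add: field_simps)
  \<comment> \<open>The bound 20 is factored so that its logarithm comes from ln 2 and ln(5/4) \<le>
    1/4. The resulting square 1.929 is below (17/12)^2, about 2.007.\<close>
  also have "\<dots> \<le> 16 * (5 / 4)" using pi_approx(2) by simp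
  finally have "ln (1 / y) \<le> ln (16 * (5 / 4))" using assms by (subst ln_le_cancel_iff) auto
  also have "\<dots> = ln 16 + ln (5 / 4)" by (subst ln_mult) auto
  also have "ln 16 = 4 * ln (2::real)" using ln_realpow[of 2 4] by simp
  also have "4 * ln 2 + ln (5 / 4) \<le> 4 * (25 / 36) + (1 / 4 :: real)"
    using ln_le_minus_one[of "5 / 4"] ln2_le_25_over_36 by simp
  finally have l: "ln (1 / y) \<le> 4 * (25 / 36) + 1 / 4" .
  have "2 * ln (1 / y) / pi \<le> 2 * (4 * (25 / 36) + 1 / 4) / (314 / 100)"
    using l assms pi_approx(1) by (intro frac_le) auto
  also have "\<dots> < (17 / 12)\<^sup>2" by (simp add: power2_eq_square)
  finally have "gauss_dist y < 17 / 12"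
    unfolding gauss_dist_def by (intro real_less_lsqrt) auto
  then show ?thesis using sinc_dist_ge_two_lobes[OF assms] by simp
qed

section \<open>The single crossing\<close>

text \<open>\<open>v\<close> is the supremum of the levels at which \<open>sinc_dist\<close> is
  strictly larger, so no equation between the two functions has to be solved. What remains is that
  \<open>sinc_dist\<close> stays at least as large below any such level.\<close>

lemma distribution_functions_cross_once:
  obtains v where "0 < v" "v < 1" "\<And>y. 0 < y \<Longrightarrow> y < v \<Longrightarrow> gauss_dist y \<le> sinc_dist y"
    "\<And>y. v < y \<Longrightarrow> y < 1 \<Longrightarrow> sinc_dist y \<le> gauss_dist y"
proof -
  obtain \<tau> where \<tau>: "7 / 6 \<le> \<tau>" "\<tau> \<le> 2" "\<And>t. 1 \<le> t \<Longrightarrow> \<bar>sinc_pi t\<bar> \<le> \<bar>sinc_pi \<tau>\<bar>" "1 / 5 < \<bar>sinc_pi \<tau>\<bar>"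
    using sinc_pi_peak by metis
  define Y where "Y = \<bar>sinc_pi \<tau>\<bar>"
  have Y: "1 / 5 < Y" "Y \<le> 51 / 200" using \<tau> abs_sinc_pi_le_of_ge_1[of \<tau>] by (auto simp: Y_def)
  \<comment> \<open>above all side lobes only the main lobe counts, and there sinc is below the Gaussian\<close>
  have above: "sinc_dist y \<le> gauss_dist y" if y: "Y < y" "y < 1" for y
  proof -
    have "{t. t > 0 \<and> \<bar>sinc_pi t\<bar> > y} \<subseteq> {0<..<gauss_dist y}"
    proof clarsimp
      fix t assume t: "0 < t" "y < \<bar>sinc_pi t\<bar>"
      have t1: "t < 1" using \<tau>(3)[of t] t y by (fastforce simp: Y_def)
      then have "pi * t < pi * 1" using t by (intro mult_strict_left_mono) auto
      then have "0 \<le> sinc_pi t" unfolding sinc_pi_def using t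
        by (intro divide_nonneg_nonneg sin_ge_zero) auto
      then have "y < exp (- pi * t\<^sup>2 / 2)" using sinc_pi_le_gauss[of t] t t1 by simp
      then show "t < gauss_dist y" using less_gauss_dist_iff[of y t] y Y t by simp
    qed
    then have "sinc_dist y \<le> measure lborel {0<..<gauss_dist y}"
      unfolding sinc_dist_def using fmeasurable_box[of 0 "gauss_dist y"]
      by (intro measure_mono_fmeasurable) (auto simp: box_real)
    also have "0 \<le> gauss_dist y"
      unfolding gauss_dist_def using y Y
      by (intro real_sqrt_ge_zero divide_nonneg_nonneg mult_nonneg_nonneg ln_ge_zero) auto
    then have "measure lborel {0<..<gauss_dist y} = gauss_dist y" by simp
    finally show ?thesis .
  qed
  define S where "S = {y. 0 < y \<and> y < 1 \<and> gauss_dist y < sinc_dist y}"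
  have S8: "1 / 8 \<in> S" using gauss_dist_less_sinc_dist[of "1/8"] by (simp add: S_def)
  have SY: "y \<le> Y" if "y \<in> S" for y
    using above[of y] that by (fastforce simp: S_def)
  have bdd: "bdd_above S" using SY by (auto simp: bdd_above_def)
  \<comment> \<open>Going down from \<open>z\<close> to a level \<open>y\<close> above 1/8 raises
    \<open>sinc_dist\<close> by at least 23/10 (z - y) and \<open>gauss_dist\<close> by at most
    that, so the inequality at \<open>z\<close> carries over to \<open>y\<close>.\<close>
  have down: "gauss_dist y \<le> sinc_dist y" if "z \<in> S" "0 < y" "y < z" for y z
  proof (cases "y \<le> 1 / 8")
    case True
    then show ?thesis using gauss_dist_less_sinc_dist[of y] that by simp
  next
    case False
    have "z \<le> Y" using SY that by simp
    then have "23 / 10 * (z - y) \<le> sinc_dist y - sinc_dist z"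
      using sinc_dist_slope[of \<tau> y z] \<tau> that by (simp add: Y_def)
    moreover have "gauss_dist y - gauss_dist z \<le> 23 / 10 * (z - y)"
      using gauss_dist_lipschitz[of y z] False that \<open>z \<le> Y\<close> Y by simp
    ultimately show ?thesis using that by (simp add: S_def)
  qed
  show ?thesis
  proof (rule that[of "Sup S"])
    show "0 < Sup S" using cSup_upper[OF S8 bdd] by simp
    have "Sup S \<le> Y" using S8 SY by (intro cSup_least) auto
    then show "Sup S < 1" using Y by simp
    show "gauss_dist y \<le> sinc_dist y" if y: "0 < y" "y < Sup S" for y
    proof -
      obtain z where "z \<in> S" "y < z" using less_cSup_iff[of S y] y S8 bdd by auto
      then show ?thesis using down y by blast
    qed
    show "sinc_dist y \<le> gauss_dist y" if y: "Sup S < y" "y < 1" for y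
      using cSup_upper[OF _ bdd, of y] y \<open>0 < Sup S\<close> by (force simp: S_def)
  qed
qed

subsection \<open>Nonincreasing rearrangements\<close>

context
  fixes h :: "real \<Rightarrow> real" and M :: real
  assumes bounded: "\<And>t. \<bar>h t\<bar> \<le> M"
begin

text \<open>A level at or above the bound \<open>M\<close> has an empty superlevel set. Nonemptiness
  is what gives \<open>Inf\<close> its order properties; the maximum with 1 keeps the level
  positive.\<close>

lemma rearr_levels_nonempty:
  "{\<tau>::real. \<tau> > 0 \<and> emeasure lborel {t::real. t > 0 \<and> \<bar>h t\<bar> > \<tau>} \<le> ennreal s} \<noteq> {}"
proof -
  have "\<not> \<bar>h t\<bar> > max 1 M" for t using bounded[of t] by auto
  then have "emeasure lborel {t. t > 0 \<and> \<bar>h t\<bar> > max 1 M} = 0" by (simp only: simp_thms Collect_empty_eq emeasure_empty empty_def[symmetric])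
  then have "max 1 M \<in> {\<tau>::real. \<tau> > 0 \<and> emeasure lborel {t::real. t > 0 \<and> \<bar>h t\<bar> > \<tau>} \<le> ennreal s}"
    unfolding mem_Collect_eq by (simp only:) simp
  then show ?thesis by blast
qed

lemma rearr_nonneg: "0 \<le> rearr h s"
  unfolding rearr_def by (rule cInf_greatest[OF rearr_levels_nonempty]) auto

lemma rearr_le:
  assumes "\<tau> > 0" "emeasure lborel {t. t > 0 \<and> \<bar>h t\<bar> > \<tau>} \<le> ennreal s"
  shows "rearr h s \<le> \<tau>"
  unfolding rearr_def by (rule cInf_lower) (use assms in \<open>auto simp: bdd_below_def intro: less_imp_le\<close>)

lemma rearr_ge:
  assumes "\<And>\<sigma>. 0 < \<sigma> \<Longrightarrow> \<sigma> < \<tau> \<Longrightarrow> ennreal s < emeasure lborel {t. t > 0 \<and> \<bar>h t\<bar> > \<sigma>}"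
  shows "\<tau> \<le> rearr h s"
  unfolding rearr_def
proof (rule cInf_greatest[OF rearr_levels_nonempty])
  fix \<sigma> assume "\<sigma> \<in> {\<tau>::real. \<tau> > 0 \<and> emeasure lborel {t::real. t > 0 \<and> \<bar>h t\<bar> > \<tau>} \<le> ennreal s}"
  then show "\<tau> \<le> \<sigma>" using assms[of \<sigma>] by (auto simp: not_less[symmetric])
qed

lemma rearr_antimono:
  assumes "s \<le> s'"
  shows "rearr h s' \<le> rearr h s"
  unfolding rearr_def
proof (rule cInf_superset_mono[OF rearr_levels_nonempty])
  show "bdd_below {\<tau>::real. \<tau> > 0 \<and> emeasure lborel {t::real. t > 0 \<and> \<bar>h t\<bar> > \<tau>} \<le> ennreal s'}"
    by (auto simp: bdd_below_def intro: less_imp_le)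
qed (use assms in \<open>auto intro: order_trans ennreal_leI\<close>)

lemma borel_measurable_rearr: "rearr h \<in> borel_measurable borel"
proof -
  have "mono (\<lambda>s. - rearr h s)" by (auto intro!: monoI rearr_antimono)
  then have "(\<lambda>s. - (- rearr h s)) \<in> borel_measurable borel"
    by (intro borel_measurable_uminus borel_measurable_mono)
  then show ?thesis by simp
qed

end

section \<open>Square integrals and rearrangement\<close>

text \<open>Both sides are the area of the region under the graph of the square of
  \<open>\<phi>\<close>, sliced in the two directions and exchanged by Tonelli.\<close>

lemma nn_integral_layer_cake_square:
  fixes \<phi> :: "real \<Rightarrow> real"
  assumes [measurable]: "\<phi> \<in> borel_measurable borel"
  shows "(\<integral>\<^sup>+ s\<in>{0<..}. ennreal ((\<phi> s)\<^sup>2) \<partial>lborel)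
    = (\<integral>\<^sup>+ u\<in>{0<..}. emeasure lborel {s. s > 0 \<and> u < (\<phi> s)\<^sup>2} \<partial>lborel)"
proof -
  define I :: "real \<times> real \<Rightarrow> ennreal" where
    "I = indicator {p. 0 < fst p \<and> 0 < snd p \<and> snd p < (\<phi> (fst p))\<^sup>2}"
  have [measurable]: "I \<in> borel_measurable (lborel \<Otimes>\<^sub>M lborel)"
    unfolding I_def by measurable
  have "(\<integral>\<^sup>+ s\<in>{0<..}. ennreal ((\<phi> s)\<^sup>2) \<partial>lborel) = (\<integral>\<^sup>+ s. (\<integral>\<^sup>+ u. I (s, u) \<partial>lborel) \<partial>lborel)"
  proof (intro nn_integral_cong)
    fix s
    have "(\<integral>\<^sup>+ u. I (s, u) \<partial>lborel) = (\<integral>\<^sup>+ u. indicator {0<..<(\<phi> s)\<^sup>2} u * indicator {0<..} s \<partial>lborel)"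
      by (intro nn_integral_cong) (auto simp: I_def indicator_def)
    also have "\<dots> = emeasure lborel {0<..<(\<phi> s)\<^sup>2} * indicator {0<..} s"
      by (subst nn_integral_multc) auto
    finally show "ennreal ((\<phi> s)\<^sup>2) * indicator {0<..} s = (\<integral>\<^sup>+ u. I (s, u) \<partial>lborel)" by simp
  qed
  also have "\<dots> = (\<integral>\<^sup>+ u. (\<integral>\<^sup>+ s. I (s, u) \<partial>lborel) \<partial>lborel)"
    by (rule lborel_pair.Fubini'[symmetric]) simp
  also have "\<dots> = (\<integral>\<^sup>+ u\<in>{0<..}. emeasure lborel {s. s > 0 \<and> u < (\<phi> s)\<^sup>2} \<partial>lborel)"
  proof (intro nn_integral_cong)
    fix u
    have "(\<integral>\<^sup>+ s. I (s, u) \<partial>lborel) = (\<integral>\<^sup>+ s. indicator {s. s > 0 \<and> u < (\<phi> s)\<^sup>2} s * indicator {0<..} u \<partial>lborel)"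
      by (intro nn_integral_cong) (auto simp: I_def indicator_def)
    also have "\<dots> = emeasure lborel {s. s > 0 \<and> u < (\<phi> s)\<^sup>2} * indicator {0<..} u"
      by (subst nn_integral_multc) auto
    finally show "(\<integral>\<^sup>+ s. I (s, u) \<partial>lborel) = emeasure lborel {s. s > 0 \<and> u < (\<phi> s)\<^sup>2} * indicator {0<..} u" .
  qed
  finally show ?thesis .
qed

text \<open>By the layer cake formula it suffices to compare superlevel sets: if
  \<open>rearr h s\<close> exceeds \<open>y\<close>, then \<open>s\<close> is below the measure of
  the set where |h| > y, so such \<open>s\<close> fill at most an interval of that length.\<close>

lemma nn_integral_rearr_square_le:
  fixes h :: "real \<Rightarrow> real"
  assumes [measurable]: "h \<in> borel_measurable borel" and bounded: "\<And>t. \<bar>h t\<bar> \<le> M"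
  shows "(\<integral>\<^sup>+ s\<in>{0<..}. ennreal ((rearr h s)\<^sup>2) \<partial>lborel) \<le> (\<integral>\<^sup>+ s\<in>{0<..}. ennreal ((h s)\<^sup>2) \<partial>lborel)"
proof -
  note [measurable] = borel_measurable_rearr[of h M, OF bounded]
  have "emeasure lborel {s. s > 0 \<and> u < (rearr h s)\<^sup>2} \<le> emeasure lborel {t. t > 0 \<and> u < (h t)\<^sup>2}"
    if u: "u > 0" for u
  proof -
    define y where "y = sqrt u"
    have y: "y > 0" using u by (simp add: y_def)
    \<comment> \<open>\<open>E\<close> may be infinite, as \<open>h\<close> is only assumed bounded;
      the inequality is then trivial.\<close>
    define E where "E = emeasure lborel {t. t > 0 \<and> y < \<bar>h t\<bar>}"
    have sq: "u < x\<^sup>2 \<longleftrightarrow> y < \<bar>x\<bar>" for x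
      unfolding y_def using real_sqrt_less_iff[of u "x\<^sup>2"] by simp
    have "{s. s > 0 \<and> u < (rearr h s)\<^sup>2} \<subseteq> {s. s > 0 \<and> ennreal s < E}"
      using rearr_le[of h M, OF bounded y] rearr_nonneg[of h M, OF bounded] unfolding E_def sq
      by (force simp: not_less[symmetric])
    then have "emeasure lborel {s. s > 0 \<and> u < (rearr h s)\<^sup>2} \<le> emeasure lborel {s. s > 0 \<and> ennreal s < E}"
      by (intro emeasure_mono) auto
    also have "\<dots> \<le> E"
    proof (cases E)
      case (real e)
      then have "{s. s > 0 \<and> ennreal s < E} = {0<..<e}" by (auto simp: ennreal_less_iff)
      then show ?thesis using real by simp
    qed simp
    finally show ?thesis by (simp add: E_def sq)
  qed
  then show ?thesis
    unfolding nn_integral_layer_cake_square[OF borel_measurable_rearr[of h M, OF bounded]]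
      nn_integral_layer_cake_square[OF assms(1)]
    by (intro nn_integral_mono) (auto simp: indicator_def)
qed

subsection \<open>Comparison with the Gaussian\<close>

text \<open>The substitution u = a t^2 in Euler's integral for Gamma(\<alpha>/2).\<close>

lemma nn_integral_gauss_powr:
  fixes a \<alpha> :: real
  assumes "a > 0" "\<alpha> > 0"
  shows "(\<integral>\<^sup>+ t\<in>{0<..}. ennreal (exp (- a * t\<^sup>2) * t powr (\<alpha> - 1)) \<partial>lborel)
    = ennreal (1 / 2 * a powr (- \<alpha> / 2) * Gamma (\<alpha> / 2))"
proof -
  define s where "s = \<alpha> / 2"
  have s: "s > 0" using assms by (simp add: s_def)
  define f where "f u = u powr (s - 1) / exp u" for u :: real
  define g where "g t = a * t\<^sup>2" for t :: real
  have "(f has_integral Gamma s) {0..}" unfolding f_def using Gamma_integral_real[OF s] .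
  \<comment> \<open>The null point 0 is dropped to match the open half-line, which \<open>g\<close>
    maps bijectively onto itself.\<close>
  moreover have "(f has_integral Gamma s) {0..} \<longleftrightarrow> (f has_integral Gamma s) {0<..}"
    by (rule has_integral_spike_set_eq) (rule negligible_subset[of "{0}"], auto)+
  ultimately have "(f has_integral Gamma s) {0<..}" by simp
  then have f_int: "f absolutely_integrable_on {0<..}" "integral {0<..} f = Gamma s"
    by (auto intro!: nonnegative_absolutely_integrable_1 simp: f_def has_integral_integrable)
  have img: "g ` {0<..} = {0<..}"
  proof
    show "{0<..} \<subseteq> g ` {0<..}"
    proof
      fix u :: real assume "u \<in> {0<..}"
      then have "u = g (sqrt (u / a))" "sqrt (u / a) \<in> {0<..}" using assms by (auto simp: g_def)
      then show "u \<in> g ` {0<..}" by blast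
    qed
  qed (use assms in \<open>auto simp: g_def\<close>)
  have inj: "inj_on g {0<..}" using assms by (auto simp: inj_on_def g_def)
  have "(\<lambda>t. \<bar>2 * a * t\<bar> * f (g t)) absolutely_integrable_on {0<..} \<and>
      integral {0<..} (\<lambda>t. \<bar>2 * a * t\<bar> * f (g t)) = Gamma s"
  proof (subst has_absolute_integral_change_of_variables_1'[where g = g and f = f])
    show "(g has_real_derivative 2 * a * t) (at t within {0<..})" for t
      unfolding g_def [abs_def] by (auto intro!: derivative_eq_intros)
  qed (use inj f_int in \<open>auto simp: img\<close>)
  then have "((\<lambda>t. \<bar>2 * a * t\<bar> * f (g t)) has_integral Gamma s) {0<..}"
    by (metis absolutely_integrable_on_def integrable_integral)
  then have "((\<lambda>t. (1 / 2 * a powr (- s)) * (\<bar>2 * a * t\<bar> * f (g t))) has_integral (1 / 2 * a powr (- s)) * Gamma s) {0<..}"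
    by (rule has_integral_mult_right)
  also have "?this \<longleftrightarrow> ((\<lambda>t. exp (- a * t\<^sup>2) * t powr (\<alpha> - 1)) has_integral (1 / 2 * a powr (- s)) * Gamma s) {0<..}"
  proof (rule has_integral_cong)
    fix t :: real assume "t \<in> {0<..}"
    then have t: "t > 0" by simp
    have "(g t) powr (s - 1) = a powr (s - 1) * t powr (2 * (s - 1))"
      using assms t powr_powr[of t 2 "s - 1"] by (simp add: g_def powr_mult)
    moreover have "a powr (- s) * a * a powr (s - 1) = 1"
    proof -
      have "a powr (- s) * a powr 1 * a powr (s - 1) = a powr (- s + 1 + (s - 1))"
        by (simp only: powr_add)
      then show ?thesis using assms by simp
    qed
    moreover have "t * t powr (2 * (s - 1)) = t powr (\<alpha> - 1)"
    proof -
      have "t powr 1 * t powr (2 * (s - 1)) = t powr (1 + 2 * (s - 1))" by (simp only: powr_add)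
      then show ?thesis using t by (simp add: s_def)
    qed
    moreover have "1 / 2 * a powr (- s) * (\<bar>2 * a * t\<bar> * (X * Y / exp (g t))) =
      (a powr (- s) * a * X) * (t * Y) * exp (- g t)" for X Y
      using assms t by (simp add: exp_minus divide_simps)
    ultimately show "1 / 2 * a powr (- s) * (\<bar>2 * a * t\<bar> * f (g t)) = exp (- a * t\<^sup>2) * t powr (\<alpha> - 1)"
      by (simp add: f_def g_def)
  qed
  finally show ?thesis
    using nn_integral_has_integral_lebesgue'[of "{0<..}" "\<lambda>t. exp (- a * t\<^sup>2) * t powr (\<alpha> - 1)"]
    by (simp add: s_def)
qed

text \<open>The constant is the ratio of the derivatives of x^q and x^2 at \<open>v\<close>. As q
  \<ge> 2 this ratio is nondecreasing in x, so x^q minus the scaled square is nondecreasing to the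
  right of \<open>v\<close>.\<close>

lemma powr_diff_ge:
  fixes v q a b :: real
  assumes "0 < v" "2 \<le> q" "v \<le> a" "a \<le> b"
  shows "q / 2 * v powr (q - 2) * (b\<^sup>2 - a\<^sup>2) \<le> b powr q - a powr q"
proof -
  define F where "F x = x powr q - q / 2 * v powr (q - 2) * x\<^sup>2" for x
  have "F a \<le> F b"
  proof (rule DERIV_nonneg_imp_nondecreasing[OF \<open>a \<le> b\<close>])
    fix x assume "a \<le> x" "x \<le> b"
    then have x: "v \<le> x" "0 < x" using assms by auto
    have "(F has_real_derivative q * x powr (q - 1) - q * v powr (q - 2) * x) (at x)"
      unfolding F_def [abs_def] using x by (auto intro!: derivative_eq_intros)
    moreover have "x powr (q - 1) = x powr (q - 2) * x"
      using x powr_add[of x "q - 2" 1] by simp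
    moreover have "v powr (q - 2) * x \<le> x powr (q - 2) * x"
      using x assms by (intro mult_right_mono powr_mono2) auto
    then have "q * (v powr (q - 2) * x) \<le> q * (x powr (q - 2) * x)" using assms by (intro mult_left_mono) auto
    ultimately show "\<exists>y. (F has_real_derivative y) (at x) \<and> 0 \<le> y" by (auto simp: mult.assoc)
  qed
  then show ?thesis unfolding F_def right_diff_distrib by linarith
qed

text \<open>The counterpart to the left of \<open>v\<close>, where the same difference is
  nonincreasing.\<close>

lemma powr_diff_le:
  fixes v q a b :: real
  assumes "2 \<le> q" "0 < b" "b \<le> a" "a \<le> v"
  shows "a powr q - b powr q \<le> q / 2 * v powr (q - 2) * (a\<^sup>2 - b\<^sup>2)"
proof -
  define F where "F x = x powr q - q / 2 * v powr (q - 2) * x\<^sup>2" for x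
  have "F a \<le> F b"
  proof (rule DERIV_nonpos_imp_nonincreasing[OF \<open>b \<le> a\<close>])
    fix x assume "b \<le> x" "x \<le> a"
    then have x: "x \<le> v" "0 < x" using assms by auto
    have "(F has_real_derivative q * x powr (q - 1) - q * v powr (q - 2) * x) (at x)"
      unfolding F_def [abs_def] using x by (auto intro!: derivative_eq_intros)
    moreover have "x powr (q - 1) = x powr (q - 2) * x"
      using x powr_add[of x "q - 2" 1] by simp
    moreover have "x powr (q - 2) * x \<le> v powr (q - 2) * x"
      using x assms by (intro mult_right_mono powr_mono2) auto
    then have "q * (x powr (q - 2) * x) \<le> q * (v powr (q - 2) * x)" using assms by (intro mult_left_mono) auto
    ultimately show "\<exists>y. (F has_real_derivative y) (at x) \<and> y \<le> 0" by (auto simp: mult.assoc)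
  qed
  then show ?thesis unfolding F_def right_diff_distrib by linarith
qed

section \<open>From distribution functions to the integral inequality\<close>

text \<open>The rearrangement is the generalized inverse of the distribution function, so the
  crossing at height \<open>v\<close> becomes one at abscissa \<open>gauss_dist v\<close>. The point
  \<open>T\<close> itself is left open; it is a null set for the integrals.\<close>

lemma rearr_sinc_pi_crosses_gauss:
  obtains v T where "0 < v" "0 < T"
    "\<And>s. 0 < s \<Longrightarrow> s < T \<Longrightarrow> v \<le> rearr sinc_pi s \<and> rearr sinc_pi s \<le> exp (- pi * s\<^sup>2 / 2)"
    "\<And>s. T < s \<Longrightarrow> exp (- pi * s\<^sup>2 / 2) \<le> rearr sinc_pi s \<and> rearr sinc_pi s \<le> v"
proof -
  obtain v where v: "0 < v" "v < 1"
    and below: "\<And>y. 0 < y \<Longrightarrow> y < v \<Longrightarrow> gauss_dist y \<le> sinc_dist y"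
    and above: "\<And>y. v < y \<Longrightarrow> y < 1 \<Longrightarrow> sinc_dist y \<le> gauss_dist y"
    using distribution_functions_cross_once by metis
  note le = rearr_le[of sinc_pi 1, OF abs_sinc_pi_le_1]
  note ge = rearr_ge[of sinc_pi 1, OF abs_sinc_pi_le_1]
  define T where "T = gauss_dist v"
  define g where "g s = exp (- pi * s\<^sup>2 / 2)" for s :: real
  have T: "0 < T" using less_gauss_dist_iff[of v 0] v by (simp add: T_def)
  have T_less: "T < s \<longleftrightarrow> g s < v" if "0 < s" for s
  proof
    assume "T < s"
    show "g s < v"
    proof (rule ccontr)
      assume "\<not> g s < v"
      then have "gauss_dist (g s) \<le> gauss_dist v"
        using gauss_dist_strict_antimono[of v "g s"] v by (cases "g s = v") (auto simp: g_def)
      then show False using \<open>T < s\<close> gauss_dist_gauss[of s] that by (simp add: T_def g_def)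
    qed
  next
    assume "g s < v"
    then have "gauss_dist v < gauss_dist (g s)"
      using gauss_dist_strict_antimono[of "g s" v] v by (auto simp: g_def)
    then show "T < s" using gauss_dist_gauss[of s] that by (simp add: T_def g_def)
  qed
  show ?thesis
  proof (rule that[OF v(1) T])
    fix s assume s: "0 < s" "s < T"
    have g: "v < g s" using less_gauss_dist_iff[of v s] s v by (simp add: T_def g_def)
    have "g s < 1" using s by (simp add: g_def)
    then have "sinc_dist (g s) \<le> s" using above[of "g s"] g gauss_dist_gauss[of s] s by (simp add: g_def)
    then have "rearr sinc_pi s \<le> g s"
      using g v by (intro le) (auto simp: emeasure_superlevel_sinc_pi intro: ennreal_leI)
    moreover have "v \<le> rearr sinc_pi s"
    proof (rule ge)
      fix \<sigma> assume \<sigma>: "0 < \<sigma>" "\<sigma> < v"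
      then have "s < sinc_dist \<sigma>"
        using below[of \<sigma>] gauss_dist_strict_antimono[of \<sigma> v] v s by (simp add: T_def)
      then show "ennreal s < emeasure lborel {t. 0 < t \<and> \<sigma> < \<bar>sinc_pi t\<bar>}"
        using \<sigma> s by (simp add: emeasure_superlevel_sinc_pi ennreal_less_iff)
    qed
    ultimately show "v \<le> rearr sinc_pi s \<and> rearr sinc_pi s \<le> exp (- pi * s\<^sup>2 / 2)" by (simp add: g_def)
  next
    fix s assume s: "T < s"
    then have s0: "0 < s" using T by simp
    have g: "0 < g s" "g s < v" using T_less[OF s0] s by (auto simp: g_def)
    \<comment> \<open>The comparison of distribution functions is available only strictly above
      \<open>v\<close>, so \<open>v\<close> is approached by levels \<open>\<tau>\<close> from
      above.\<close>
    have "rearr sinc_pi s \<le> v"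
    proof (rule dense_ge_bounded[OF v(2)])
      fix \<tau> assume \<tau>: "v < \<tau>" "\<tau> < 1"
      then have "sinc_dist \<tau> \<le> s"
        using above[of \<tau>] gauss_dist_strict_antimono[of v \<tau>] v s by (simp add: T_def)
      then show "rearr sinc_pi s \<le> \<tau>"
        using \<tau> v by (intro le) (auto simp: emeasure_superlevel_sinc_pi intro: ennreal_leI)
    qed
    moreover have "g s \<le> rearr sinc_pi s"
    proof (rule ge)
      fix \<sigma> assume \<sigma>: "0 < \<sigma>" "\<sigma> < g s"
      then have "s < gauss_dist \<sigma>"
        using gauss_dist_strict_antimono[of \<sigma> "g s"] gauss_dist_gauss[of s] s0 g v by (simp add: g_def)
      then have "s < sinc_dist \<sigma>" using below[of \<sigma>] \<sigma> g by simp
      then show "ennreal s < emeasure lborel {t. 0 < t \<and> \<sigma> < \<bar>sinc_pi t\<bar>}"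
        using \<sigma> s0 by (simp add: emeasure_superlevel_sinc_pi ennreal_less_iff)
    qed
    ultimately show "exp (- pi * s\<^sup>2 / 2) \<le> rearr sinc_pi s \<and> rearr sinc_pi s \<le> v" by (simp add: g_def)
  qed
qed

lemma nn_integral_rearr_sinc_pi_le:
  fixes q \<alpha> :: real
  assumes q: "2 \<le> q" and \<alpha>: "0 < \<alpha>" "\<alpha> \<le> 1"
  shows "(\<integral>\<^sup>+ t\<in>{0<..}. ennreal ((rearr sinc_pi t) powr q * t powr (\<alpha> - 1)) \<partial>lborel)
    \<le> (\<integral>\<^sup>+ t\<in>{0<..}. ennreal (exp (- pi * q * t\<^sup>2 / 2) * t powr (\<alpha> - 1)) \<partial>lborel)" (is "?L \<le> ?R")
proof -
  obtain v T where v: "0 < v" and T: "0 < T"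
    and left: "\<And>s. 0 < s \<Longrightarrow> s < T \<Longrightarrow> v \<le> rearr sinc_pi s \<and> rearr sinc_pi s \<le> exp (- pi * s\<^sup>2 / 2)"
    and right: "\<And>s. T < s \<Longrightarrow> exp (- pi * s\<^sup>2 / 2) \<le> rearr sinc_pi s \<and> rearr sinc_pi s \<le> v"
    using rearr_sinc_pi_crosses_gauss by metis
  define f where "f = rearr sinc_pi"
  define g where "g s = exp (- pi * s\<^sup>2 / 2)" for s :: real
  define C where "C = q / 2 * v powr (q - 2)"
  define c where "c = C * T powr (\<alpha> - 1)"
  have C: "0 \<le> C" using q by (simp add: C_def)
  have c: "0 \<le> c" using C by (simp add: c_def)
  have fm [measurable]: "f \<in> borel_measurable borel"
    unfolding f_def by (rule borel_measurable_rearr[of sinc_pi 1, OF abs_sinc_pi_le_1])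
  have gm [measurable]: "g \<in> borel_measurable borel" unfolding g_def by measurable
  \<comment> \<open>both factors of \<open>(f\<^sup>q - g\<^sup>q) s\<^bsup>\<alpha>-1\<^esup>\<close> are compared with their values at the crossing point\<close>
  have pointwise: "f s powr q * s powr (\<alpha> - 1) + c * (g s)\<^sup>2 \<le> g s powr q * s powr (\<alpha> - 1) + c * (f s)\<^sup>2"
    if s: "0 < s" "s \<noteq> T" for s
  proof (cases "s < T")
    case True
    then have fg: "v \<le> f s" "f s \<le> g s" using left s by (auto simp: f_def g_def)
    have sq: "(f s)\<^sup>2 \<le> (g s)\<^sup>2" using fg v by (intro power_mono) auto
    \<comment> \<open>\<open>\<alpha> \<le> 1\<close> makes the weight nonincreasing: it is at least
      its value at \<open>T\<close> on the left and at most that on the right, matching the sign of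
      g - f on each side.\<close>
    have w: "T powr (\<alpha> - 1) \<le> s powr (\<alpha> - 1)" using True s \<alpha> by (intro powr_mono2') auto
    have "C * ((g s)\<^sup>2 - (f s)\<^sup>2) * T powr (\<alpha> - 1) \<le> (g s powr q - f s powr q) * s powr (\<alpha> - 1)"
    proof (rule mult_mono[OF _ w])
      show le: "C * ((g s)\<^sup>2 - (f s)\<^sup>2) \<le> g s powr q - f s powr q"
        unfolding C_def using powr_diff_ge[of v q "f s" "g s"] v q fg by simp
      have "0 \<le> C * ((g s)\<^sup>2 - (f s)\<^sup>2)" using C sq by simp
      then show "0 \<le> g s powr q - f s powr q" using le by simp
    qed simp
    then show ?thesis by (simp add: c_def algebra_simps)
  next
    case False
    then have fg: "g s \<le> f s" "f s \<le> v" using right[of s] s by (auto simp: f_def g_def)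
    have g0: "0 < g s" by (simp add: g_def)
    have sq: "(g s)\<^sup>2 \<le> (f s)\<^sup>2" using fg g0 by (intro power_mono) auto
    have w: "s powr (\<alpha> - 1) \<le> T powr (\<alpha> - 1)" using False s T \<alpha> by (intro powr_mono2') auto
    have "(f s powr q - g s powr q) * s powr (\<alpha> - 1) \<le> C * ((f s)\<^sup>2 - (g s)\<^sup>2) * T powr (\<alpha> - 1)"
    proof (rule mult_mono[OF _ w])
      show "f s powr q - g s powr q \<le> C * ((f s)\<^sup>2 - (g s)\<^sup>2)"
        unfolding C_def using powr_diff_le[of q "g s" "f s" v] q fg g0 by simp
      show "0 \<le> C * ((f s)\<^sup>2 - (g s)\<^sup>2)" using C sq by simp
    qed simp
    then show ?thesis by (simp add: c_def algebra_simps)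
  qed
  have Rg: "?R = (\<integral>\<^sup>+ s\<in>{0<..}. ennreal (g s powr q * s powr (\<alpha> - 1)) \<partial>lborel)"
    by (intro nn_integral_cong) (simp add: g_def powr_def algebra_simps)
  have g2: "(\<integral>\<^sup>+ s\<in>{0<..}. ennreal ((g s)\<^sup>2) \<partial>lborel) = ennreal (1 / 2)"
  proof -
    \<comment> \<open>The moment formula with a = pi and exponent 1; Gamma(1/2) = sqrt pi cancels
      the prefactor.\<close>
    have "(\<integral>\<^sup>+ s\<in>{0<..}. ennreal ((g s)\<^sup>2) \<partial>lborel)
        = (\<integral>\<^sup>+ s\<in>{0<..}. ennreal (exp (- pi * s\<^sup>2) * s powr (1 - 1)) \<partial>lborel)"
      by (intro nn_integral_cong) (auto simp: g_def indicator_def simp flip: exp_double)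
    also have "\<dots> = ennreal (1 / 2 * pi powr (- 1 / 2) * Gamma (1 / 2))"
      by (rule nn_integral_gauss_powr) auto
    also have "pi powr (- 1 / 2) * Gamma (1 / 2) = 1"
      by (simp add: Gamma_one_half_real powr_minus powr_half_sqrt)
    then have "1 / 2 * pi powr (- 1 / 2) * Gamma (1 / 2) = 1 / 2" by simp
    finally show ?thesis .
  qed
  have f2: "(\<integral>\<^sup>+ s\<in>{0<..}. ennreal ((f s)\<^sup>2) \<partial>lborel) \<le> ennreal (1 / 2)"
    unfolding f_def nn_integral_sinc_pi_square[symmetric]
    by (rule nn_integral_rearr_square_le[OF borel_measurable_sinc_pi abs_sinc_pi_le_1])
  have split: "(\<integral>\<^sup>+ s. ennreal (a s powr q * s powr (\<alpha> - 1) + c * (b s)\<^sup>2) * indicator {0<..} s \<partial>lborel)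
      = (\<integral>\<^sup>+ s\<in>{0<..}. ennreal (a s powr q * s powr (\<alpha> - 1)) \<partial>lborel)
        + ennreal c * (\<integral>\<^sup>+ s\<in>{0<..}. ennreal ((b s)\<^sup>2) \<partial>lborel)"
    if [measurable]: "a \<in> borel_measurable borel" "b \<in> borel_measurable borel" for a b :: "real \<Rightarrow> real"
    using c by (simp add: ennreal_plus ennreal_mult distrib_right nn_integral_add nn_integral_cmult mult.assoc)
  \<comment> \<open>The square terms stand on opposite sides, so that only nonnegative functions are
    integrated and no subtraction in \<open>ennreal\<close> occurs.\<close>
  have "?L + ennreal c * ennreal (1 / 2)
      = (\<integral>\<^sup>+ s. ennreal (f s powr q * s powr (\<alpha> - 1) + c * (g s)\<^sup>2) * indicator {0<..} s \<partial>lborel)"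
    unfolding split[OF fm gm] g2 by (simp add: f_def)
  also have "\<dots> \<le> (\<integral>\<^sup>+ s. ennreal (g s powr q * s powr (\<alpha> - 1) + c * (f s)\<^sup>2) * indicator {0<..} s \<partial>lborel)"
  proof (rule nn_integral_mono_AE)
    show "AE s in lborel. ennreal (f s powr q * s powr (\<alpha> - 1) + c * (g s)\<^sup>2) * indicator {0<..} s
        \<le> ennreal (g s powr q * s powr (\<alpha> - 1) + c * (f s)\<^sup>2) * indicator {0<..} s"
      using AE_lborel_singleton[of T]
      by eventually_elim (auto simp: indicator_def intro!: ennreal_leI pointwise)
  qed
  also have "\<dots> = ?R + ennreal c * (\<integral>\<^sup>+ s\<in>{0<..}. ennreal ((f s)\<^sup>2) \<partial>lborel)"
    unfolding split[OF gm fm] Rg ..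
  also have "\<dots> \<le> ?R + ennreal c * ennreal (1 / 2)"
    by (intro add_left_mono mult_left_mono f2) simp
  \<comment> \<open>The common summand c/2 is finite and can be cancelled, even if an integral were
    infinite.\<close>
  finally have "ennreal c * ennreal (1 / 2) + ?L \<le> ennreal c * ennreal (1 / 2) + ?R"
    by (simp only: add.commute)
  then show ?thesis
    by (subst (asm) ennreal_add_left_cancel_le) (auto simp: ennreal_mult_eq_top_iff)
qed

section \<open>Rescaling to sin t / t\<close>

text \<open>Since \<open>sinc (pi * t) = sinc_pi t\<close>, dilation by pi multiplies the measure of
  every superlevel set by pi, which rescales the argument of the rearrangement.\<close>

lemma rearr_sinc: "rearr sinc s = rearr sinc_pi (s / pi)"
proof -
  have "emeasure lborel {t. t > 0 \<and> \<bar>sinc t\<bar> > \<tau>} = ennreal pi * emeasure lborel {t. t > 0 \<and> \<bar>sinc_pi t\<bar> > \<tau>}" for \<tau>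
  proof -
    have [measurable]: "sinc \<in> borel_measurable borel" unfolding Defs.sinc_def by measurable
    have "emeasure lborel {t. t > 0 \<and> \<bar>sinc t\<bar> > \<tau>} = (\<integral>\<^sup>+ t. indicator {t. t > 0 \<and> \<bar>sinc t\<bar> > \<tau>} t \<partial>lborel)"
      by (rule nn_integral_indicator[symmetric]) simp
    also have "\<dots> = ennreal \<bar>pi\<bar> * (\<integral>\<^sup>+ t. indicator {t. t > 0 \<and> \<bar>sinc t\<bar> > \<tau>} (0 + pi * t) \<partial>lborel)"
      by (rule nn_integral_real_affine) auto
    also have "(\<integral>\<^sup>+ t. indicator {t. t > 0 \<and> \<bar>sinc t\<bar> > \<tau>} (0 + pi * t) \<partial>lborel)
        = (\<integral>\<^sup>+ t. indicator {t. t > 0 \<and> \<bar>sinc_pi t\<bar> > \<tau>} t \<partial>lborel)"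
      by (intro nn_integral_cong) (auto simp: indicator_def Defs.sinc_def sinc_pi_def zero_less_mult_iff)
    also have "\<dots> = emeasure lborel {t. t > 0 \<and> \<bar>sinc_pi t\<bar> > \<tau>}"
      by (rule nn_integral_indicator) simp
    finally show ?thesis by simp
  qed
  \<comment> \<open>For negative \<open>s\<close> both right-hand sides are truncated to 0 by
    \<open>ennreal\<close>.\<close>
  moreover have "ennreal pi * E \<le> ennreal s \<longleftrightarrow> E \<le> ennreal (s / pi)" for E
  proof (cases "s \<ge> 0")
    case True
    then show ?thesis
      by (cases E) (auto simp: ennreal_mult[symmetric] ennreal_mult_top field_simps top_unique)
  next
    case False
    then have "s / pi < 0" by (simp add: divide_neg_pos)
    then show ?thesis using False by (simp add: ennreal_neg)
  qed
  ultimately show ?thesis unfolding rearr_def by simp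
qed

theorem mainTheorem9:
  shows "(\<forall>p q :: real. 2 \<le> q \<and> q \<le> p \<longrightarrow>
           (\<integral>\<^sup>+ t\<in>{0<..}. ennreal ((rearr sinc_pi t) powr q * t powr (q / p - 1)) \<partial>lborel)
         \<le> (\<integral>\<^sup>+ t\<in>{0<..}. ennreal (exp (- pi * q * t\<^sup>2 / 2) * t powr (q / p - 1)) \<partial>lborel))
       \<and> (\<forall>q \<alpha> :: real. 2 \<le> q \<and> 0 < \<alpha> \<and> \<alpha> \<le> 1 \<longrightarrow>
           (\<integral>\<^sup>+ t\<in>{0<..}. ennreal ((rearr sinc t) powr q * t powr (\<alpha> - 1)) \<partial>lborel)
         \<le> ennreal (1 / 2 * q powr (- \<alpha> / 2) * (2 * pi) powr (\<alpha> / 2) * Gamma (\<alpha> / 2)))"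
proof (intro conjI allI impI)
  fix p q :: real assume "2 \<le> q \<and> q \<le> p"
  then show "(\<integral>\<^sup>+ t\<in>{0<..}. ennreal ((rearr sinc_pi t) powr q * t powr (q / p - 1)) \<partial>lborel)
         \<le> (\<integral>\<^sup>+ t\<in>{0<..}. ennreal (exp (- pi * q * t\<^sup>2 / 2) * t powr (q / p - 1)) \<partial>lborel)"
    \<comment> \<open>The exponent \<open>q / p\<close> lies in (0, 1].\<close>
    by (intro nn_integral_rearr_sinc_pi_le) auto
next
  fix q \<alpha> :: real assume "2 \<le> q \<and> 0 < \<alpha> \<and> \<alpha> \<le> 1"
  then have q: "2 \<le> q" and \<alpha>: "0 < \<alpha>" "\<alpha> \<le> 1" by auto
  have [measurable]: "rearr sinc_pi \<in> borel_measurable borel"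
    by (rule borel_measurable_rearr[of sinc_pi 1, OF abs_sinc_pi_le_1])
  let ?I = "\<integral>\<^sup>+ t\<in>{0<..}. ennreal ((rearr sinc_pi t) powr q * t powr (\<alpha> - 1)) \<partial>lborel"
  \<comment> \<open>The substitution t -> pi t: its Jacobian pi and the weight together give the
    factor pi^\<alpha>.\<close>
  have "(\<integral>\<^sup>+ t\<in>{0<..}. ennreal ((rearr sinc t) powr q * t powr (\<alpha> - 1)) \<partial>lborel)
      = ennreal \<bar>pi\<bar> * (\<integral>\<^sup>+ t. ennreal ((rearr sinc_pi ((0 + pi * t) / pi)) powr q * (0 + pi * t) powr (\<alpha> - 1))
          * indicator {0<..} (0 + pi * t) \<partial>lborel)"
    unfolding rearr_sinc by (rule nn_integral_real_affine) auto
  also have "(\<integral>\<^sup>+ t. ennreal ((rearr sinc_pi ((0 + pi * t) / pi)) powr q * (0 + pi * t) powr (\<alpha> - 1))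
          * indicator {0<..} (0 + pi * t) \<partial>lborel)
      = (\<integral>\<^sup>+ t. ennreal (pi powr (\<alpha> - 1)) * (ennreal ((rearr sinc_pi t) powr q * t powr (\<alpha> - 1)) * indicator {0<..} t) \<partial>lborel)"
    by (intro nn_integral_cong)
       (auto simp: indicator_def zero_less_mult_iff powr_mult ennreal_mult[symmetric] mult_ac)
  also have "\<dots> = ennreal (pi powr (\<alpha> - 1)) * ?I"
    by (rule nn_integral_cmult) simp
  also have "ennreal \<bar>pi\<bar> * (ennreal (pi powr (\<alpha> - 1)) * ?I) = ennreal (pi powr \<alpha>) * ?I"
    using powr_add[of pi 1 "\<alpha> - 1"] by (simp add: mult.assoc[symmetric] ennreal_mult[symmetric])
  also have "\<dots> \<le> ennreal (pi powr \<alpha>) * (\<integral>\<^sup>+ t\<in>{0<..}. ennreal (exp (- pi * q * t\<^sup>2 / 2) * t powr (\<alpha> - 1)) \<partial>lborel)"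
    by (intro mult_left_mono nn_integral_rearr_sinc_pi_le q \<alpha>) simp
  also have "(\<integral>\<^sup>+ t\<in>{0<..}. ennreal (exp (- pi * q * t\<^sup>2 / 2) * t powr (\<alpha> - 1)) \<partial>lborel)
      = (\<integral>\<^sup>+ t\<in>{0<..}. ennreal (exp (- (pi * q / 2) * t\<^sup>2) * t powr (\<alpha> - 1)) \<partial>lborel)" by simp
  also have "\<dots> = ennreal (1 / 2 * (pi * q / 2) powr (- \<alpha> / 2) * Gamma (\<alpha> / 2))"
    using q \<alpha> by (intro nn_integral_gauss_powr) auto
  also have "ennreal (pi powr \<alpha>) * \<dots> = ennreal (pi powr \<alpha> * (1 / 2 * (pi * q / 2) powr (- \<alpha> / 2) * Gamma (\<alpha> / 2)))"
    by (rule ennreal_mult''[symmetric]) (use \<alpha> in \<open>auto intro: less_imp_le Gamma_real_pos\<close>)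
  also have "pi powr \<alpha> * (1 / 2 * (pi * q / 2) powr (- \<alpha> / 2) * Gamma (\<alpha> / 2))
      = 1 / 2 * q powr (- \<alpha> / 2) * (2 * pi) powr (\<alpha> / 2) * Gamma (\<alpha> / 2)"
  proof -
    \<comment> \<open>One half of pi^\<alpha> cancels against (pi q/2)^(-\<alpha>/2); the other half
      joins 2^(\<alpha>/2).\<close>
    have "pi powr \<alpha> = pi powr (\<alpha> / 2) * pi powr (\<alpha> / 2)" by (simp flip: powr_add)
    then have "pi powr \<alpha> * (pi * q / 2) powr (- \<alpha> / 2) = q powr (- \<alpha> / 2) * (2 * pi) powr (\<alpha> / 2)"
      using q by (simp add: powr_divide powr_mult powr_minus field_simps)
    then show ?thesis by simp
  qed
  finally show "(\<integral>\<^sup>+ t\<in>{0<..}. ennreal ((rearr sinc t) powr q * t powr (\<alpha> - 1)) \<partial>lborel)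
         \<le> ennreal (1 / 2 * q powr (- \<alpha> / 2) * (2 * pi) powr (\<alpha> / 2) * Gamma (\<alpha> / 2))" .
qed

end
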